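(* Let $A=kQ/I$ be a finite-dimensional algebra, where $I$ is an admissible ideal of $kQ$ and the quiver $Q$ has exactly three vertices $1,2,3$ and admits as a subquiver the quiver with two arrows $2\rightrightarrows 1$, two arrows $1\rightrightarrows 3$ and two arrows $3\rightrightarrows 2$. Then there is no maximal green sequence in $\operatorname{mod}A$.
   Context: $k$ is a field and $\operatorname{mod}A$ is the category of finitely generated $A$-modules. A maximal green sequence in $\operatorname{mod}A$ is a finite chain of torsion classes $\{0\}=\mathcal{T}_0\subsetneq\mathcal{T}_1\subsetneq\dots\subsetneq\mathcal{T}_r=\operatorname{mod}A$ such that for every $i\in\{0,\dots,r-1\}$, any torsion class $\mathcal{T}$ with $\mathcal{T}_i\subseteq\mathcal{T}\subseteq\mathcal{T}_{i+1}$ satisfies $\mathcal{T}=\mathcal{T}_i$ or $\mathcal{T}=\mathcal{T}_{i+1}$. *)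

theory Defs
  imports
    "Graph_Theory.Digraph_Component"
    "HOL-Library.Poly_Mapping"
    "HOL-Algebra.Ideal_Product"
    "HOL-Algebra.QuotRing"
    "HOL-Algebra.Module"
begin

section \<open>Path algebras and admissible ideals\<close>

text \<open>A quiver is a directed multigraph with loops allowed, that is, a
  \<^type>\<open>pre_digraph\<close>. A path is a triple (source, list of arrows in the order in which
  they are traversed, target); the trivial path at \<open>v\<close> is \<open>(v, [], v)\<close>.\<close>

type_synonym ('v, 'e) qpath = "'v \<times> 'e list \<times> 'v"

abbreviation path_source :: "('v, 'e) qpath \<Rightarrow> 'v" where
  "path_source p \<equiv> fst p"

abbreviation path_arrows :: "('v, 'e) qpath \<Rightarrow> 'e list" where
  "path_arrows p \<equiv> fst (snd p)"

abbreviation path_target :: "('v, 'e) qpath \<Rightarrow> 'v" where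
  "path_target p \<equiv> snd (snd p)"

definition paths :: "('v, 'e) pre_digraph \<Rightarrow> ('v, 'e) qpath set" where
  "paths Q = {(u, es, v). pre_digraph.awalk Q u es v}"

text \<open>Paths are composed like functions: first \<open>q\<close>, then \<open>p\<close>. Hence left modules over the path
  algebra correspond to (covariant) representations of the quiver.\<close>

definition path_comp :: "('v, 'e) qpath \<Rightarrow> ('v, 'e) qpath \<Rightarrow> ('v, 'e) qpath" where
  "path_comp p q = (path_source q, path_arrows q @ path_arrows p, path_target p)"

definition path_mult ::
  "(('v, 'e) qpath \<Rightarrow>\<^sub>0 'k::field) \<Rightarrow> (('v, 'e) qpath \<Rightarrow>\<^sub>0 'k) \<Rightarrow> (('v, 'e) qpath \<Rightarrow>\<^sub>0 'k)" where
  "path_mult f g =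
     (\<Sum>(p, q) \<in> {(p, q). p \<in> Poly_Mapping.keys f \<and> q \<in> Poly_Mapping.keys g \<and>
                            path_source p = path_target q}.
        Poly_Mapping.single (path_comp p q) (Poly_Mapping.lookup f p * Poly_Mapping.lookup g q))"

definition path_algebra :: "('v, 'e) pre_digraph \<Rightarrow> (('v, 'e) qpath \<Rightarrow>\<^sub>0 'k::field) ring" where
  "path_algebra Q =
     \<lparr>carrier = {f. Poly_Mapping.keys f \<subseteq> paths Q},
      mult = path_mult,
      one = (\<Sum>v \<in> verts Q. Poly_Mapping.single (v, [], v) 1),
      zero = 0,
      add = (+)\<rparr>"

definition arrow_ideal :: "('v, 'e) pre_digraph \<Rightarrow> (('v, 'e) qpath \<Rightarrow>\<^sub>0 'k::field) set" where
  "arrow_ideal Q =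
     genideal (path_algebra Q)
       {Poly_Mapping.single (tail Q e, [e], head Q e) 1 | e. e \<in> arcs Q}"

text \<open>Admissibility is meant for finite quivers; then the quotient by an admissible ideal
  is finite-dimensional, as it is spanned by the classes of the finitely many paths of length less
  than \<open>m\<close>. Powers of the arrow ideal are powers with respect to the product of ideals, which is the
  multiplication of \<^const>\<open>ideals_set\<close>. Ideals of the ring \<open>kQ\<close> are automatically
  \<open>k\<close>-subspaces, since \<open>kQ\<close> has a unit.\<close>

definition admissible_ideal ::
  "('v, 'e) pre_digraph \<Rightarrow> (('v, 'e) qpath \<Rightarrow>\<^sub>0 'k::field) set \<Rightarrow> bool" where
  "admissible_ideal Q I \<longleftrightarrow>
     ideal I (path_algebra Q) \<and>
     I \<subseteq> arrow_ideal Q [^]\<^bsub>ideals_set (path_algebra Q)\<^esub> (2::nat) \<and>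
     (\<exists>m::nat. m \<ge> 2 \<and> arrow_ideal Q [^]\<^bsub>ideals_set (path_algebra Q)\<^esub> m \<subseteq> I)"


section \<open>Modules over a not necessarily commutative ring\<close>

text \<open>The axioms are those of the locale \<^locale>\<open>module\<close>, which insists on a commutative ring.\<close>

locale left_module = R?: ring R + M?: abelian_group M
  for R :: "('a, 'c) ring_scheme" (structure) and M :: "('a, 'b, 'd) module_scheme" (structure) +
  assumes smult_closed [simp, intro]:
      "\<lbrakk>a \<in> carrier R; x \<in> carrier M\<rbrakk> \<Longrightarrow> a \<odot>\<^bsub>M\<^esub> x \<in> carrier M"
    and smult_l_distr:
      "\<lbrakk>a \<in> carrier R; b \<in> carrier R; x \<in> carrier M\<rbrakk> \<Longrightarrow>
       (a \<oplus>\<^bsub>R\<^esub> b) \<odot>\<^bsub>M\<^esub> x = a \<odot>\<^bsub>M\<^esub> x \<oplus>\<^bsub>M\<^esub> b \<odot>\<^bsub>M\<^esub> x"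
    and smult_r_distr:
      "\<lbrakk>a \<in> carrier R; x \<in> carrier M; y \<in> carrier M\<rbrakk> \<Longrightarrow>
       a \<odot>\<^bsub>M\<^esub> (x \<oplus>\<^bsub>M\<^esub> y) = a \<odot>\<^bsub>M\<^esub> x \<oplus>\<^bsub>M\<^esub> a \<odot>\<^bsub>M\<^esub> y"
    and smult_assoc1:
      "\<lbrakk>a \<in> carrier R; b \<in> carrier R; x \<in> carrier M\<rbrakk> \<Longrightarrow>
       (a \<otimes>\<^bsub>R\<^esub> b) \<odot>\<^bsub>M\<^esub> x = a \<odot>\<^bsub>M\<^esub> (b \<odot>\<^bsub>M\<^esub> x)"
    and smult_one [simp]:
      "x \<in> carrier M \<Longrightarrow> \<one>\<^bsub>R\<^esub> \<odot>\<^bsub>M\<^esub> x = x"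

definition finitely_generated_module ::
  "('a, 'c) ring_scheme \<Rightarrow> ('a, 'b, 'd) module_scheme \<Rightarrow> bool" where
  "finitely_generated_module R M \<longleftrightarrow>
     (\<exists>S. finite S \<and> S \<subseteq> carrier M \<and> (\<forall>N. submodule N R M \<and> S \<subseteq> N \<longrightarrow> N = carrier M))"

definition left_module_hom ::
  "('a, 'c) ring_scheme \<Rightarrow> ('a, 'b, 'd) module_scheme \<Rightarrow> ('a, 'm, 'n) module_scheme \<Rightarrow> ('b \<Rightarrow> 'm) set"
  where
  "left_module_hom R M N =
     {f \<in> carrier M \<rightarrow> carrier N.
        (\<forall>x \<in> carrier M. \<forall>y \<in> carrier M. f (x \<oplus>\<^bsub>M\<^esub> y) = f x \<oplus>\<^bsub>N\<^esub> f y) \<and>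
        (\<forall>a \<in> carrier R. \<forall>x \<in> carrier M. f (a \<odot>\<^bsub>M\<^esub> x) = a \<odot>\<^bsub>N\<^esub> f x)}"

text \<open>The objects of \<open>mod R\<close>. In order to speak of classes of modules, the elements of modules are
  drawn from the type of sets of sequences in \<open>R\<close>; this restricts modules only up to isomorphism,
  as every finitely generated module is a quotient of some \<open>R\<^sup>n\<close>
  (lemma \<open>finitely_generated_module_has_copy\<close> below).\<close>

definition fg_modules :: "('a, 'c) ring_scheme \<Rightarrow> ('a, (nat \<Rightarrow> 'a) set) module set" where
  "fg_modules R = {M. left_module R M \<and> finitely_generated_module R M}"


section \<open>Torsion classes and maximal green sequences\<close>

text \<open>A full subcategory is identified with its set of objects. A torsion class is a nonempty full
  subcategory closed under quotients and extensions. Closure under isomorphism is the special case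
  of a bijective \<open>f\<close> in the quotient clause.\<close>

definition torsion_class ::
  "('a, 'c) ring_scheme \<Rightarrow> ('a, (nat \<Rightarrow> 'a) set) module set \<Rightarrow> bool" where
  "torsion_class R T \<longleftrightarrow>
     T \<subseteq> fg_modules R \<and> T \<noteq> {} \<and>
     (\<forall>M \<in> T. \<forall>N \<in> fg_modules R.
        (\<exists>f \<in> left_module_hom R M N. f ` carrier M = carrier N) \<longrightarrow> N \<in> T) \<and>
     (\<forall>L \<in> T. \<forall>N \<in> T. \<forall>M \<in> fg_modules R.
        (\<exists>f \<in> left_module_hom R L M. \<exists>g \<in> left_module_hom R M N.
           inj_on f (carrier L) \<and> f ` carrier L = a_kernel M N g \<and> g ` carrier M = carrier N)
        \<longrightarrow> M \<in> T)"

definition zero_modules :: "('a, 'c) ring_scheme \<Rightarrow> ('a, (nat \<Rightarrow> 'a) set) module set" where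
  "zero_modules R = {M \<in> fg_modules R. carrier M = {\<zero>\<^bsub>M\<^esub>}}"

definition maximal_green_sequence ::
  "('a, 'c) ring_scheme \<Rightarrow> nat \<Rightarrow> (nat \<Rightarrow> ('a, (nat \<Rightarrow> 'a) set) module set) \<Rightarrow> bool" where
  "maximal_green_sequence R r \<T> \<longleftrightarrow>
     \<T> 0 = zero_modules R \<and> \<T> r = fg_modules R \<and>
     (\<forall>i \<le> r. torsion_class R (\<T> i)) \<and>
     (\<forall>i < r. \<T> i \<subset> \<T> (Suc i)) \<and>
     (\<forall>i < r. \<forall>\<T>'. torsion_class R \<T>' \<and> \<T> i \<subseteq> \<T>' \<and> \<T>' \<subseteq> \<T> (Suc i) \<longrightarrow>
        \<T>' = \<T> i \<or> \<T>' = \<T> (Suc i))"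


section \<open>The cyclic quiver with double arrows\<close>

definition double_cyclic_triangle :: "(nat, 'e) pre_digraph \<Rightarrow> bool" where
  "double_cyclic_triangle H \<longleftrightarrow>
     verts H = {1, 2, 3} \<and>
     (\<exists>a a' b b' c c'.
        distinct [a, a', b, b', c, c'] \<and> arcs H = {a, a', b, b', c, c'} \<and>
        arc_to_ends H a = (2, 1) \<and> arc_to_ends H a' = (2, 1) \<and>
        arc_to_ends H b = (1, 3) \<and> arc_to_ends H b' = (1, 3) \<and>
        arc_to_ends H c = (3, 2) \<and> arc_to_ends H c' = (3, 2))"


section \<open>The path algebra is a ring\<close>

lemma path_mult_superset:
  assumes "finite A" "finite B" "Poly_Mapping.keys f \<subseteq> A" "Poly_Mapping.keys g \<subseteq> B"
  shows "path_mult f g = (\<Sum>p\<in>A. \<Sum>q\<in>B. if path_source p = path_target q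
           then Poly_Mapping.single (path_comp p q) (Poly_Mapping.lookup f p * Poly_Mapping.lookup g q) else 0)"
proof -
  let ?h = "\<lambda>(p, q). if path_source p = path_target q
           then Poly_Mapping.single (path_comp p q) (Poly_Mapping.lookup f p * Poly_Mapping.lookup g q) else 0"
  have "path_mult f g = sum ?h (A \<times> B)"
    unfolding path_mult_def
  proof (rule sum.mono_neutral_cong_left)
    show "finite (A \<times> B)" using assms by simp
    show "{(p, q). p \<in> Poly_Mapping.keys f \<and> q \<in> Poly_Mapping.keys g \<and> path_source p = path_target q} \<subseteq> A \<times> B"
      using assms by auto
  qed (auto simp: in_keys_iff split: if_splits)
  then show ?thesis by (simp add: sum.cartesian_product)
qed

lemma path_mult_add_left: "path_mult (f + f') g = path_mult f g + path_mult f' g"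
proof -
  let ?A = "Poly_Mapping.keys f \<union> Poly_Mapping.keys f'"
  have k: "Poly_Mapping.keys (f + f') \<subseteq> ?A" by (rule Poly_Mapping.keys_add)
  show ?thesis
    using k by (auto simp: path_mult_superset[where A = ?A and B = "Poly_Mapping.keys g"] lookup_add
        distrib_right single_add sum.distrib [symmetric] intro!: sum.cong)
qed

lemma path_mult_add_right: "path_mult f (g + g') = path_mult f g + path_mult f g'"
proof -
  let ?B = "Poly_Mapping.keys g \<union> Poly_Mapping.keys g'"
  have k: "Poly_Mapping.keys (g + g') \<subseteq> ?B" by (rule Poly_Mapping.keys_add)
  show ?thesis
    using k by (auto simp: path_mult_superset[where A = "Poly_Mapping.keys f" and B = ?B] lookup_add
        distrib_left single_add sum.distrib [symmetric] intro!: sum.cong)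
qed

lemma path_mult_zero [simp]: "path_mult 0 g = 0" "path_mult f 0 = 0"
  by (simp_all add: path_mult_def)

lemma path_mult_single:
  "path_mult (Poly_Mapping.single p a) (Poly_Mapping.single q b) =
     (if path_source p = path_target q then Poly_Mapping.single (path_comp p q) (a * b) else 0)"
  by (subst path_mult_superset[where A = "{p}" and B = "{q}"]) (auto simp: lookup_single)

lemma poly_mapping_add_induct [consumes 1, case_names zero single add]:
  assumes "Poly_Mapping.keys f \<subseteq> S"
    and "P 0"
    and "\<And>p a. p \<in> S \<Longrightarrow> P (Poly_Mapping.single p a)"
    and add: "\<And>f g. P f \<Longrightarrow> P g \<Longrightarrow> P (f + g)"
  shows "P (f :: 'b \<Rightarrow>\<^sub>0 'k::field)"
  using assms(1)
proof (induction f rule: Poly_Mapping.update_induct)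
  case const
  show ?case by (rule assms(2))
next
  case (update f a b)
  have eq: "Poly_Mapping.update a b f = f + Poly_Mapping.single a b"
    using update.hyps(1)
    by (intro poly_mapping_eqI)
      (auto simp: lookup_update lookup_add lookup_single when_def in_keys_iff)
  have "Poly_Mapping.keys (Poly_Mapping.update a b f) = insert a (Poly_Mapping.keys f)"
    using update.hyps(2) by (simp add: keys_update)
  with update.prems have "a \<in> S" "Poly_Mapping.keys f \<subseteq> S" by auto
  then show ?case
    unfolding eq using update.IH assms(3) by (intro add) auto
qed

lemma path_mult_assoc_single:
  "path_mult (path_mult (Poly_Mapping.single p a) (Poly_Mapping.single q b)) (Poly_Mapping.single r c) =
   path_mult (Poly_Mapping.single p a) (path_mult (Poly_Mapping.single q b) (Poly_Mapping.single r c))"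
proof -
  have "path_source (path_comp p q) = path_source q" "path_target (path_comp q r) = path_target q"
    "path_comp (path_comp p q) r = path_comp p (path_comp q r)"
    by (simp_all add: path_comp_def)
  then show ?thesis by (simp add: path_mult_single mult.assoc)
qed

lemma path_mult_assoc: "path_mult (path_mult f g) h = path_mult f (path_mult g h)"
proof -
  have 1: "path_mult (path_mult (Poly_Mapping.single p a) (Poly_Mapping.single q b)) h =
      path_mult (Poly_Mapping.single p a) (path_mult (Poly_Mapping.single q b) h)" for p a q b
    by (rule poly_mapping_add_induct[OF subset_UNIV, of _ h])
      (simp_all only: path_mult_zero path_mult_assoc_single path_mult_add_right)
  have 2: "path_mult (path_mult (Poly_Mapping.single p a) g) h =
      path_mult (Poly_Mapping.single p a) (path_mult g h)" for p a
    by (rule poly_mapping_add_induct[OF subset_UNIV, of _ g])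
      (simp_all only: path_mult_zero 1 path_mult_add_left path_mult_add_right)
  show ?thesis
    by (rule poly_mapping_add_induct[OF subset_UNIV, of _ f])
      (simp_all only: path_mult_zero 2 path_mult_add_left)
qed

lemma path_comp_in_paths:
  assumes "wf_digraph Q" "p \<in> paths Q" "q \<in> paths Q" "path_source p = path_target q"
  shows "path_comp p q \<in> paths Q"
  using assms wf_digraph.awalk_appendI[OF assms(1)]
  by (auto simp: paths_def path_comp_def)

lemma keys_path_mult:
  assumes "wf_digraph Q" "Poly_Mapping.keys f \<subseteq> paths Q" "Poly_Mapping.keys g \<subseteq> paths Q"
  shows "Poly_Mapping.keys (path_mult f g) \<subseteq> paths Q"
proof -
  have "Poly_Mapping.keys (path_mult f g) \<subseteq>
     (\<Union>z\<in>{(p, q). p \<in> Poly_Mapping.keys f \<and> q \<in> Poly_Mapping.keys g \<and> path_source p = path_target q}.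
        Poly_Mapping.keys (case z of (p, q) \<Rightarrow>
          Poly_Mapping.single (path_comp p q) (Poly_Mapping.lookup f p * Poly_Mapping.lookup g q)))"
    unfolding path_mult_def by (rule Poly_Mapping.keys_sum)
  also have "\<dots> \<subseteq> paths Q"
    using assms(2,3) by (auto split: if_splits intro!: path_comp_in_paths[OF assms(1)])
  finally show ?thesis .
qed

lemma path_mult_sum_left: "path_mult (\<Sum>x\<in>X. F x) g = (\<Sum>x\<in>X. path_mult (F x) g)"
  by (induction X rule: infinite_finite_induct) (simp_all add: path_mult_add_left)

lemma path_mult_sum_right: "path_mult f (\<Sum>x\<in>X. G x) = (\<Sum>x\<in>X. path_mult f (G x))"
  by (induction X rule: infinite_finite_induct) (simp_all add: path_mult_add_right)

lemma path_ends_in_verts: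
  assumes "wf_digraph Q" "p \<in> paths Q"
  shows "path_source p \<in> verts Q" "path_target p \<in> verts Q"
proof -
  obtain u es v where p: "p = (u, es, v)" by (rule prod_cases3)
  then have "pre_digraph.awalk Q u es v" using assms(2) by (simp add: paths_def)
  then show "path_source p \<in> verts Q" "path_target p \<in> verts Q"
    using wf_digraph.awalk_hd_in_verts[OF assms(1)] wf_digraph.awalk_last_in_verts[OF assms(1)]
    by (simp_all add: p)
qed

proposition path_algebra_ring:
  assumes "fin_digraph Q"
  shows "ring (path_algebra Q :: (('v, 'e) qpath \<Rightarrow>\<^sub>0 'k::field) ring)"
proof -
  interpret Q: fin_digraph Q by fact
  have wf: "wf_digraph Q" by (rule Q.wf_digraph)
  let ?A = "path_algebra Q :: (('v, 'e) qpath \<Rightarrow>\<^sub>0 'k) ring"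
  let ?e = "\<Sum>v \<in> verts Q. Poly_Mapping.single (v, [], v) (1 :: 'k)"
  have triv: "(v, [], v) \<in> paths Q" if "v \<in> verts Q" for v
    using that by (simp add: paths_def pre_digraph.awalk_def pre_digraph.cas.simps)
  have one: "Poly_Mapping.keys ?e \<subseteq> paths Q"
  proof -
    have "Poly_Mapping.keys ?e \<subseteq> (\<Union>v\<in>verts Q. Poly_Mapping.keys (Poly_Mapping.single (v, [], v) (1 :: 'k)))"
      by (rule Poly_Mapping.keys_sum)
    also have "\<dots> \<subseteq> paths Q" using triv by auto
    finally show ?thesis .
  qed
  have l_one: "path_mult ?e f = f" if "Poly_Mapping.keys f \<subseteq> paths Q" for f :: "('v, 'e) qpath \<Rightarrow>\<^sub>0 'k"
    using that
  proof (induction f rule: poly_mapping_add_induct)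
    case (single p a)
    have "path_mult ?e (Poly_Mapping.single p a) =
        (\<Sum>v\<in>verts Q. if v = path_target p then Poly_Mapping.single p a else 0)"
      unfolding path_mult_sum_left path_mult_single
      by (intro sum.cong) (auto simp: path_comp_def)
    then show ?case using path_ends_in_verts[OF wf single] by (simp add: sum.delta)
  qed (simp_all add: path_mult_add_right)
  have r_one: "path_mult f ?e = f" if "Poly_Mapping.keys f \<subseteq> paths Q" for f :: "('v, 'e) qpath \<Rightarrow>\<^sub>0 'k"
    using that
  proof (induction f rule: poly_mapping_add_induct)
    case (single p a)
    have "path_mult (Poly_Mapping.single p a) ?e =
        (\<Sum>v\<in>verts Q. if v = path_source p then Poly_Mapping.single p a else 0)"
      unfolding path_mult_sum_right path_mult_single
      by (intro sum.cong) (auto simp: path_comp_def)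
    then show ?case using path_ends_in_verts[OF wf single] by (simp add: sum.delta)
  qed (simp_all add: path_mult_add_left)
  show ?thesis
  proof (rule ringI)
    show "abelian_group ?A"
    proof (rule abelian_groupI)
      fix x assume "x \<in> carrier ?A"
      then have "- x \<in> carrier ?A" "- x \<oplus>\<^bsub>?A\<^esub> x = \<zero>\<^bsub>?A\<^esub>"
        by (simp_all add: path_algebra_def)
      then show "\<exists>y\<in>carrier ?A. y \<oplus>\<^bsub>?A\<^esub> x = \<zero>\<^bsub>?A\<^esub>" by blast
    next
      fix x y assume "x \<in> carrier ?A" "y \<in> carrier ?A"
      then show "x \<oplus>\<^bsub>?A\<^esub> y \<in> carrier ?A"
        using Poly_Mapping.keys_add[of x y] by (auto simp: path_algebra_def)
    qed (simp_all add: path_algebra_def add_ac)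
    show "monoid ?A"
      by (rule monoidI)
        (use one in \<open>simp_all add: path_algebra_def l_one r_one keys_path_mult[OF wf] path_mult_assoc\<close>)
  qed (simp_all add: path_algebra_def path_mult_add_left path_mult_add_right)
qed


section \<open>Every finitely generated module has an isomorphic copy in \<open>fg_modules\<close>\<close>

text \<open>Transport of structure along an injection \<open>h\<close> of the carrier. The ring multiplication and unit
  are fields of the record that play no role for modules.\<close>

definition transport_module ::
  "('b \<Rightarrow> 'm) \<Rightarrow> ('a, 'b, 'd) module_scheme \<Rightarrow> ('a, 'm) module" where
  "transport_module h M =
     (let k = inv_into (carrier M) h in
      \<lparr>carrier = h ` carrier M, mult = (\<lambda>x y. undefined), one = undefined,
       zero = h \<zero>\<^bsub>M\<^esub>, add = (\<lambda>x y. h (k x \<oplus>\<^bsub>M\<^esub> k y)),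
       smult = (\<lambda>a x. h (a \<odot>\<^bsub>M\<^esub> k x))\<rparr>)"

lemma (in left_module) transport_module:
  assumes inj: "inj_on h (carrier M)"
  shows "left_module R (transport_module h M)"
    and "h \<in> left_module_hom R M (transport_module h M)"
    and "bij_betw h (carrier M) (carrier (transport_module h M))"
    and "finitely_generated_module R M \<Longrightarrow> finitely_generated_module R (transport_module h M)"
proof -
  let ?N = "transport_module h M"
  have k: "inv_into (carrier M) h (h x) = x" if "x \<in> carrier M" for x
    using inj that by simp
  have carr: "carrier ?N = h ` carrier M" and zero: "\<zero>\<^bsub>?N\<^esub> = h \<zero>\<^bsub>M\<^esub>"
    by (simp_all add: transport_module_def Let_def)
  have add: "h x \<oplus>\<^bsub>?N\<^esub> h y = h (x \<oplus>\<^bsub>M\<^esub> y)" if "x \<in> carrier M" "y \<in> carrier M" for x y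
    using that by (simp add: transport_module_def Let_def k)
  have smult: "a \<odot>\<^bsub>?N\<^esub> h x = h (a \<odot>\<^bsub>M\<^esub> x)" if "x \<in> carrier M" for a x
    using that by (simp add: transport_module_def Let_def k)
  have ab: "abelian_group ?N"
  proof (rule abelian_groupI)
    fix x assume "x \<in> carrier ?N"
    then obtain y where "y \<in> carrier M" "x = h y" by (auto simp: carr)
    then have "h (\<ominus>\<^bsub>M\<^esub> y) \<in> carrier ?N \<and> h (\<ominus>\<^bsub>M\<^esub> y) \<oplus>\<^bsub>?N\<^esub> x = \<zero>\<^bsub>?N\<^esub>"
      by (simp add: carr add zero M.l_neg)
    then show "\<exists>z\<in>carrier ?N. z \<oplus>\<^bsub>?N\<^esub> x = \<zero>\<^bsub>?N\<^esub>" by blast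
  qed (auto simp: carr zero add M.a_ac)
  show "left_module R ?N"
    by (intro left_module.intro left_module_axioms.intro ab R.ring_axioms)
      (auto simp: carr add smult smult_l_distr smult_r_distr smult_assoc1)
  show "h \<in> left_module_hom R M ?N"
    by (auto simp: left_module_hom_def carr add smult)
  show "bij_betw h (carrier M) (carrier ?N)"
    using inj by (simp add: bij_betw_def carr)
  interpret N: abelian_group ?N by (rule ab)
  show "finitely_generated_module R ?N" if fg: "finitely_generated_module R M"
  proof -
    from fg obtain S where S: "finite S" "S \<subseteq> carrier M"
      and gen: "\<And>N. submodule N R M \<Longrightarrow> S \<subseteq> N \<Longrightarrow> N = carrier M"
      unfolding finitely_generated_module_def by auto
    have "N = carrier ?N" if N: "submodule N R ?N" "h ` S \<subseteq> N" for N
    proof -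
      interpret N': submodule N R ?N by (rule N(1))
      have Nc: "N \<subseteq> carrier ?N" using N'.subset by simp
      let ?P = "{x \<in> carrier M. h x \<in> N}"
      have Nadd: "x \<oplus>\<^bsub>?N\<^esub> y \<in> N" if "x \<in> N" "y \<in> N" for x y
        using N'.m_closed that by simp
      have Nneg: "h (\<ominus>\<^bsub>M\<^esub> x) \<in> N" if "x \<in> carrier M" "h x \<in> N" for x
      proof -
        have "h (\<ominus>\<^bsub>M\<^esub> x) \<oplus>\<^bsub>?N\<^esub> h x = \<zero>\<^bsub>?N\<^esub>" using that by (simp add: add zero M.l_neg)
        then have "h (\<ominus>\<^bsub>M\<^esub> x) = \<ominus>\<^bsub>?N\<^esub> h x"
          using that by (intro N.minus_equality [symmetric]) (auto simp: carr)
        also have "\<dots> \<in> N" using N'.m_inv_closed[OF that(2)] by (simp add: a_inv_def)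
        finally show ?thesis .
      qed
      have "submodule ?P R M"
      proof (intro submodule.intro submodule_axioms.intro)
        show "subgroup ?P (add_monoid M)"
        proof (rule group.subgroupI)
          show "group (add_monoid M)" by (rule M.a_group)
          have "h \<zero>\<^bsub>M\<^esub> \<in> N" using N'.one_closed by (simp add: zero)
          then show "?P \<noteq> {}" using M.zero_closed by blast
        next
          fix a assume "a \<in> ?P"
          then show "inv\<^bsub>add_monoid M\<^esub> a \<in> ?P"
            using Nneg M.a_inv_closed by (auto simp: a_inv_def)
        next
          fix a b assume "a \<in> ?P" "b \<in> ?P"
          then show "a \<otimes>\<^bsub>add_monoid M\<^esub> b \<in> ?P" using Nadd by (auto simp: add [symmetric])
        qed auto
        show "a \<odot>\<^bsub>M\<^esub> x \<in> ?P" if "a \<in> carrier R" "x \<in> ?P" for a x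
          using that N'.smult_closed[of a "h x"] by (auto simp: smult)
      qed
      then have "?P = carrier M" using S N(2) by (intro gen) auto
      then have "carrier ?N \<subseteq> N" by (auto simp: carr)
      with Nc show ?thesis by blast
    qed
    then show ?thesis
      unfolding finitely_generated_module_def
      using S by (intro exI[of _ "h ` S"]) (auto simp: carr)
  qed
qed

lemma (in left_module) smult_zero:
  assumes "x \<in> carrier M"
  shows "\<zero>\<^bsub>R\<^esub> \<odot>\<^bsub>M\<^esub> x = \<zero>\<^bsub>M\<^esub>"
proof -
  have "\<zero>\<^bsub>R\<^esub> \<odot>\<^bsub>M\<^esub> x = \<zero>\<^bsub>R\<^esub> \<odot>\<^bsub>M\<^esub> x \<oplus>\<^bsub>M\<^esub> \<zero>\<^bsub>R\<^esub> \<odot>\<^bsub>M\<^esub> x"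
    using smult_l_distr[of "\<zero>\<^bsub>R\<^esub>" "\<zero>\<^bsub>R\<^esub>" x] assms by simp
  then show ?thesis using assms by (metis M.add.r_cancel_one' R.zero_closed smult_closed)
qed

proposition (in left_module) finitely_generated_module_has_copy:
  assumes "finitely_generated_module R M"
  shows "\<exists>N \<in> fg_modules R. \<exists>f \<in> left_module_hom R M N. bij_betw f (carrier M) (carrier N)"
proof -
  from assms obtain S where S: "finite S" "S \<subseteq> carrier M"
    and gen: "\<And>N. submodule N R M \<Longrightarrow> S \<subseteq> N \<Longrightarrow> N = carrier M"
    unfolding finitely_generated_module_def by auto
  obtain x and n :: nat where x: "S = x ` {i. i < n}"
    using S(1) finite_imp_nat_seg_image_inj_on by metis
  have xc: "x i \<in> carrier M" if "i < n" for i using S(2) x that by auto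
  define comb where "comb c = (\<Oplus>\<^bsub>M\<^esub>i\<in>{..<n}. c i \<odot>\<^bsub>M\<^esub> x i)" for c :: "nat \<Rightarrow> 'a"
  define coeffs where "coeffs = {..<n} \<rightarrow> carrier R"
  define h where "h m = {c \<in> coeffs. comb c = m}" for m
  have closed: "comb c \<in> carrier M" if "c \<in> coeffs" for c
    unfolding comb_def using that xc by (intro M.finsum_closed) (auto simp: coeffs_def)
  have smult_minus: "(\<ominus>\<^bsub>R\<^esub> \<one>\<^bsub>R\<^esub>) \<odot>\<^bsub>M\<^esub> y = \<ominus>\<^bsub>M\<^esub> y" if "y \<in> carrier M" for y
  proof -
    have "(\<ominus>\<^bsub>R\<^esub> \<one>\<^bsub>R\<^esub>) \<odot>\<^bsub>M\<^esub> y \<oplus>\<^bsub>M\<^esub> y = \<zero>\<^bsub>M\<^esub>"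
      using smult_l_distr[of "\<ominus>\<^bsub>R\<^esub> \<one>\<^bsub>R\<^esub>" "\<one>\<^bsub>R\<^esub>" y] that
      by (simp add: R.l_neg smult_zero)
    then show ?thesis using that by (intro M.minus_equality [symmetric]) auto
  qed
  have smult_comb: "a \<odot>\<^bsub>M\<^esub> comb c = comb (\<lambda>i. a \<otimes>\<^bsub>R\<^esub> c i)"
    if a: "a \<in> carrier R" and c: "c \<in> coeffs" for a c
  proof -
    have z: "a \<odot>\<^bsub>M\<^esub> \<zero>\<^bsub>M\<^esub> = \<zero>\<^bsub>M\<^esub>"
    proof -
      have "a \<odot>\<^bsub>M\<^esub> \<zero>\<^bsub>M\<^esub> = a \<odot>\<^bsub>M\<^esub> \<zero>\<^bsub>M\<^esub> \<oplus>\<^bsub>M\<^esub> a \<odot>\<^bsub>M\<^esub> \<zero>\<^bsub>M\<^esub>"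
        using smult_r_distr[of a "\<zero>\<^bsub>M\<^esub>" "\<zero>\<^bsub>M\<^esub>"] a by simp
      then show ?thesis using a by (metis M.add.r_cancel_one' M.zero_closed smult_closed)
    qed
    have "a \<odot>\<^bsub>M\<^esub> (\<Oplus>\<^bsub>M\<^esub>i\<in>I. c i \<odot>\<^bsub>M\<^esub> x i) = (\<Oplus>\<^bsub>M\<^esub>i\<in>I. (a \<otimes>\<^bsub>R\<^esub> c i) \<odot>\<^bsub>M\<^esub> x i)"
      if "finite I" "I \<subseteq> {..<n}" for I
      using that
    proof (induction I rule: finite_induct)
      case empty
      then show ?case by (simp add: z)
    next
      case (insert i I)
      have cl: "c j \<in> carrier R" "x j \<in> carrier M" if "j \<in> insert i I" for j
        using that insert.prems c xc by (auto simp: coeffs_def)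
      have fin: "(\<lambda>j. c j \<odot>\<^bsub>M\<^esub> x j) \<in> I \<rightarrow> carrier M"
        "(\<lambda>j. (a \<otimes>\<^bsub>R\<^esub> c j) \<odot>\<^bsub>M\<^esub> x j) \<in> I \<rightarrow> carrier M" using cl a by auto
      have i: "c i \<in> carrier R" "x i \<in> carrier M" using cl by auto
      have "a \<odot>\<^bsub>M\<^esub> (\<Oplus>\<^bsub>M\<^esub>i\<in>insert i I. c i \<odot>\<^bsub>M\<^esub> x i) =
          a \<odot>\<^bsub>M\<^esub> (c i \<odot>\<^bsub>M\<^esub> x i \<oplus>\<^bsub>M\<^esub> (\<Oplus>\<^bsub>M\<^esub>i\<in>I. c i \<odot>\<^bsub>M\<^esub> x i))"
        using M.finsum_insert[OF insert.hyps fin(1)] i by simp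
      also have "\<dots> = a \<odot>\<^bsub>M\<^esub> (c i \<odot>\<^bsub>M\<^esub> x i) \<oplus>\<^bsub>M\<^esub> a \<odot>\<^bsub>M\<^esub> (\<Oplus>\<^bsub>M\<^esub>i\<in>I. c i \<odot>\<^bsub>M\<^esub> x i)"
        using i fin a by (intro smult_r_distr smult_closed M.finsum_closed)
      also have "\<dots> = (a \<otimes>\<^bsub>R\<^esub> c i) \<odot>\<^bsub>M\<^esub> x i \<oplus>\<^bsub>M\<^esub> (\<Oplus>\<^bsub>M\<^esub>i\<in>I. (a \<otimes>\<^bsub>R\<^esub> c i) \<odot>\<^bsub>M\<^esub> x i)"
        using insert.IH insert.prems smult_assoc1[OF a i] by simp
      also have "\<dots> = (\<Oplus>\<^bsub>M\<^esub>i\<in>insert i I. (a \<otimes>\<^bsub>R\<^esub> c i) \<odot>\<^bsub>M\<^esub> x i)"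
        using M.finsum_insert[OF insert.hyps fin(2)] i a by simp
      finally show ?case .
    qed
    then show ?thesis unfolding comb_def by simp
  qed
  have sub: "submodule (comb ` coeffs) R M"
  proof (intro submodule.intro submodule_axioms.intro)
    show smul: "a \<odot>\<^bsub>M\<^esub> y \<in> comb ` coeffs" if "a \<in> carrier R" "y \<in> comb ` coeffs" for a y
      using that smult_comb by (auto simp: coeffs_def Pi_iff intro!: imageI)
    show "subgroup (comb ` coeffs) (add_monoid M)"
    proof (rule group.subgroupI)
      show "group (add_monoid M)" by (rule M.a_group)
      show "comb ` coeffs \<subseteq> carrier (add_monoid M)" using closed by auto
      have "(\<lambda>_. \<zero>\<^bsub>R\<^esub>) \<in> coeffs" by (simp add: coeffs_def)
      then show "comb ` coeffs \<noteq> {}" by blast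
    next
      fix y assume y: "y \<in> comb ` coeffs"
      then have "y \<in> carrier M" using closed by auto
      then have "\<ominus>\<^bsub>M\<^esub> y \<in> comb ` coeffs"
        using smul[OF _ y, of "\<ominus>\<^bsub>R\<^esub> \<one>\<^bsub>R\<^esub>"] smult_minus by simp
      then show "inv\<^bsub>add_monoid M\<^esub> y \<in> comb ` coeffs" by (simp only: a_inv_def)
    next
      fix y z assume "y \<in> comb ` coeffs" "z \<in> comb ` coeffs"
      then obtain c d where c: "c \<in> coeffs" "y = comb c" and d: "d \<in> coeffs" "z = comb d"
        by auto
      have "comb (\<lambda>i. c i \<oplus>\<^bsub>R\<^esub> d i) =
          (\<Oplus>\<^bsub>M\<^esub>i\<in>{..<n}. c i \<odot>\<^bsub>M\<^esub> x i \<oplus>\<^bsub>M\<^esub> d i \<odot>\<^bsub>M\<^esub> x i)"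
        unfolding comb_def using c d xc
        by (intro M.finsum_cong') (auto simp: coeffs_def smult_l_distr Pi_iff)
      also have "\<dots> = y \<oplus>\<^bsub>M\<^esub> z"
        unfolding c d comb_def using c(1) d(1) xc
        by (intro M.finsum_addf) (auto simp: coeffs_def Pi_iff)
      finally have "y \<oplus>\<^bsub>M\<^esub> z = comb (\<lambda>i. c i \<oplus>\<^bsub>R\<^esub> d i)" by simp
      moreover have "(\<lambda>i. c i \<oplus>\<^bsub>R\<^esub> d i) \<in> coeffs" using c d by (auto simp: coeffs_def)
      ultimately show "y \<otimes>\<^bsub>add_monoid M\<^esub> z \<in> comb ` coeffs" by auto
    qed
  qed
  have "S \<subseteq> comb ` coeffs"
  proof
    fix s assume "s \<in> S"
    then obtain j where j: "j < n" "s = x j" using x by auto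
    let ?c = "\<lambda>i. if i = j then \<one>\<^bsub>R\<^esub> else \<zero>\<^bsub>R\<^esub>"
    have "comb ?c = (\<Oplus>\<^bsub>M\<^esub>i\<in>{..<n}. if j = i then x i else \<zero>\<^bsub>M\<^esub>)"
      unfolding comb_def using xc by (intro M.finsum_cong') (auto simp: smult_zero)
    also have "\<dots> = x j"
      using M.finsum_singleton[of j "{..<n}" x] j xc by auto
    finally have "s = comb ?c" using j by simp
    moreover have "?c \<in> coeffs" by (simp add: coeffs_def)
    ultimately show "s \<in> comb ` coeffs" by blast
  qed
  with sub have span: "comb ` coeffs = carrier M" by (rule gen)
  have "inj_on h (carrier M)"
  proof (rule inj_onI)
    fix y z assume "y \<in> carrier M" and eq: "h y = h z"
    then obtain c where "c \<in> coeffs" "comb c = y" using span by (metis imageE)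
    then have "c \<in> h z" using eq by (auto simp: h_def)
    then show "y = z" using \<open>comb c = y\<close> by (simp add: h_def)
  qed
  from transport_module[OF this] assms show ?thesis
    unfolding fg_modules_def by blast
qed

end

theory Submission
  imports Defs "HOL-Library.Function_Algebras" "HOL-Library.Product_Plus"
begin

text \<open>For a pair of vertices \<open>s \<rightrightarrows> t\<close>, the ring \<open>A\<close> maps onto the path algebra of the Kronecker
  quiver, since the elements of \<open>I\<close> have no terms of length at most \<open>1\<close>.
  Let \<open>S\<^sub>v\<close> be the simple module at \<open>v\<close>. The key claim is that in a maximal green sequence
  \<open>S\<^sub>s \<in> T\<^sub>i\<close> implies \<open>S\<^sub>t \<in> T\<^sub>i\<close>. Let \<open>P\<^sub>n : k\<^sup>n\<^sup>+\<^sup>1 \<rightrightarrows> k\<^sup>n\<close> be the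
  preinjective Kronecker modules and \<open>T \<subset> T'\<close> the step at which \<open>T'\<close> contains all \<open>P\<^sub>n\<close>
  for the first time, say \<open>P\<^sub>n \<notin> T\<close>. Suppose \<open>S\<^sub>t \<notin> T\<close>. As \<open>Hom(P\<^sub>n, P\<^sub>n\<^sub>+\<^sub>1) = 0\<close> and
  nothing lies strictly between \<open>T\<close> and \<open>T'\<close>, some module in \<open>T\<close> has a nonzero map to
  \<open>P\<^sub>n\<^sub>+\<^sub>1\<close>. Its image \<open>Y\<close> is a proper submodule, so \<open>dim Y\<^sub>s \<le> dim Y\<^sub>t\<close>; and \<open>Y\<^sub>s \<noteq> 0\<close>
  as \<open>S\<^sub>t \<notin> T\<close>. A minimal quotient \<open>Z\<close> of \<open>P\<^sub>n\<close> outside \<open>T\<close> satisfies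
  \<open>Hom(Y, Z) = 0\<close> and \<open>dim Z\<^sub>t < dim Z\<^sub>s\<close>, which counting equations shows to be impossible. So
  \<open>S\<^sub>t \<in> T\<close>, and \<open>S\<^sub>s\<close> cannot have been added before, as \<open>S\<^sub>s\<close> and \<open>S\<^sub>t\<close> generate all
  \<open>P\<^sub>n\<close>.

  Around the cycle, the three simple modules are therefore added in the same step
  \<open>T \<subset> T'\<close>. But the modules in \<open>T'\<close> without nonzero map to \<open>S\<^sub>1\<close> form a torsion class that
  contains \<open>T\<close> and \<open>S\<^sub>2\<close>, but not \<open>S\<^sub>1\<close>.\<close>

section \<open>Linear algebra\<close>

text \<open>Gaussian elimination by induction on the equations: a row with a nonzero coefficient is
  spent on eliminating one unknown, which leaves one equation and one unknown fewer.\<close>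

lemma homogeneous_system_solution:
  fixes a :: "'e \<Rightarrow> 'x \<Rightarrow> 'k::field"
  assumes "finite E" "finite X" "card E < card X"
  shows "\<exists>c. (\<exists>x\<in>X. c x \<noteq> 0) \<and> (\<forall>e\<in>E. (\<Sum>x\<in>X. a e x * c x) = 0)"
  using assms
proof (induction E arbitrary: X a rule: finite_induct)
  case empty
  then obtain x where "x \<in> X" by (metis all_not_in_conv card.empty less_irrefl)
  then show ?case by (intro exI[of _ "\<lambda>_. 1"]) auto
next
  case (insert e E)
  show ?case
  proof (cases "\<forall>x\<in>X. a e x = 0")
    case True
    have "card E < card X" using insert by simp
    with insert.IH[OF insert.prems(1), of a] True show ?thesis by auto
  next
    case False
    then obtain z where z: "z \<in> X" "a e z \<noteq> 0" by auto
    \<comment> \<open>Row \<open>f\<close> minus the multiple of row \<open>e\<close> that cancels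
      the coefficient at \<open>z\<close>, so that \<open>z\<close> drops out of the reduced
      system.\<close>
    define b where "b f x = a f x - a f z * a e x / a e z" for f x
    have "card E < card (X - {z})" using insert z by simp
    with insert.IH[of "X - {z}" b] insert.prems(1) obtain c
      where c: "\<exists>x\<in>X - {z}. c x \<noteq> 0" "\<forall>f\<in>E. (\<Sum>x\<in>X - {z}. b f x * c x) = 0" by auto
    define s where "s = (\<Sum>x\<in>X - {z}. a e x * c x)"
    \<comment> \<open>Back substitution: the value at \<open>z\<close> is the one that solves
      equation \<open>e\<close>.\<close>
    define d where "d = c(z := - s / a e z)"
    have sum: "(\<Sum>x\<in>X. a f x * d x) = - (a f z * s / a e z) + (\<Sum>x\<in>X - {z}. a f x * c x)" for f
      using sum.remove[OF insert.prems(1) z(1), of "\<lambda>x. a f x * d x"] by (simp add: d_def)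
    have "(\<Sum>x\<in>X. a f x * d x) = 0" if "f \<in> E" for f
    proof -
      have "(\<Sum>x\<in>X - {z}. b f x * c x) =
          (\<Sum>x\<in>X - {z}. a f x * c x) - (\<Sum>x\<in>X - {z}. a f z / a e z * (a e x * c x))"
        unfolding b_def sum_subtractf[symmetric] by (intro sum.cong) (auto simp: algebra_simps)
      also have "\<dots> = (\<Sum>x\<in>X - {z}. a f x * c x) - a f z * s / a e z"
        by (simp add: s_def sum_distrib_left sum_divide_distrib)
      finally show ?thesis using c(2) that by (simp add: sum)
    qed
    moreover have "(\<Sum>x\<in>X. a e x * d x) = 0" using z by (simp add: sum s_def)
    moreover have "\<exists>x\<in>X. d x \<noteq> 0" using c(1) by (auto simp: d_def)
    ultimately show ?thesis by auto
  qed
qed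

section \<open>Dimension theory for finite-dimensional subspaces\<close>

locale linear_space = vector_space scale
  for scale :: "'k::field \<Rightarrow> 'v::ab_group_add \<Rightarrow> 'v"
begin

abbreviation "lin \<equiv> Vector_Spaces.linear scale scale"

sublocale endo: vector_space_pair scale scale ..

text \<open>Finiteness is a property of subsets because the ambient space of sequences used below is
  itself infinite-dimensional.\<close>

definition fin_dim :: "'v set \<Rightarrow> bool" where
  "fin_dim V \<longleftrightarrow> (\<exists>B. finite B \<and> V \<subseteq> span B)"

lemma fin_dim_subset: "fin_dim W \<Longrightarrow> V \<subseteq> W \<Longrightarrow> fin_dim V"
  unfolding fin_dim_def by blast

lemma fin_dim_image: "lin f \<Longrightarrow> fin_dim V \<Longrightarrow> fin_dim (f ` V)"
  unfolding fin_dim_def by (meson endo.linear_spans_image finite_imageI)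

lemma fin_dim_independent: "fin_dim V \<Longrightarrow> B \<subseteq> V \<Longrightarrow> independent B \<Longrightarrow> finite B"
  unfolding fin_dim_def by (meson independent_span_bound order_trans)

lemma fin_dim_basis_extend:
  assumes "fin_dim V" "subspace V" "independent C" "C \<subseteq> V"
  obtains B where "C \<subseteq> B" "B \<subseteq> V" "finite B" "independent B" "span B = V" "card B = dim V"
proof -
  obtain B where B: "C \<subseteq> B" "B \<subseteq> V" "independent B" "V \<subseteq> span B"
    using maximal_independent_subset_extend[OF assms(4,3)] by metis
  moreover have "finite B" using fin_dim_independent assms(1) B by blast
  ultimately show ?thesis
    using that span_subspace[OF B(2,4) assms(2)] dim_unique[OF B(2,4,3) refl] by auto
qed

lemma fin_dim_basis:
  assumes "fin_dim V" "subspace V"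
  obtains B where "B \<subseteq> V" "finite B" "independent B" "span B = V" "card B = dim V"
  using fin_dim_basis_extend[OF assms, of "{}"] independent_empty by auto

lemma fin_dim_dim_mono:
  assumes "fin_dim W" "subspace V" "subspace W" "V \<subseteq> W"
  shows "dim V \<le> dim W" and "dim V = dim W \<Longrightarrow> V = W"
proof -
  have fV: "fin_dim V" using assms fin_dim_subset by blast
  obtain B where B: "B \<subseteq> V" "finite B" "independent B" "span B = V" "card B = dim V"
    using fin_dim_basis[OF fV assms(2)] .
  obtain C where C: "B \<subseteq> C" "C \<subseteq> W" "finite C" "independent C" "span C = W" "card C = dim W"
    using fin_dim_basis_extend[OF assms(1,3) B(3)] B assms(4) by blast
  show "dim V \<le> dim W" using B C by (metis card_mono)
  show "dim V = dim W \<Longrightarrow> V = W" using B C by (metis card_subset_eq)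
qed

lemma fin_dim_dim_eq_0:
  assumes "fin_dim V" "subspace V" "dim V = 0"
  shows "V = {0}"
proof -
  have "dim {0} = 0" using dim_le_card[of "{0}" "{}"] by simp
  then show ?thesis
    using fin_dim_dim_mono(2)[OF assms(1) subspace_single_0 assms(2)] assms(3) subspace_0[OF assms(2)] by auto
qed

text \<open>A basis \<open>B\<close> of the kernel extends to a basis \<open>C\<close> of
  \<open>V\<close>; \<open>f\<close> is injective on the span of \<open>C - B\<close>, so the images
  of these vectors form a basis of the image.\<close>

lemma rank_nullity:
  assumes "fin_dim V" "subspace V" "lin f"
  shows "dim (f ` V) + dim {x \<in> V. f x = 0} = dim V"
proof -
  interpret f: Vector_Spaces.linear scale scale f by fact
  let ?K = "{x \<in> V. f x = 0}"
  have K: "subspace ?K" "fin_dim ?K"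
    using assms(2) fin_dim_subset[OF assms(1)]
    by (auto simp: subspace_def f.add f.scale)
  obtain B where B: "B \<subseteq> ?K" "finite B" "independent B" "span B = ?K" "card B = dim ?K"
    using fin_dim_basis[OF K(2,1)] .
  obtain C where C: "B \<subseteq> C" "C \<subseteq> V" "finite C" "independent C" "span C = V" "card C = dim V"
    using fin_dim_basis_extend[OF assms(1,2) B(3)] B by blast
  let ?D = "C - B"
  have inj: "inj_on f (span ?D)"
  proof (subst f.inj_on_iff_eq_0)
    show "subspace (span ?D)" by simp
    show "\<forall>x\<in>span ?D. f x = 0 \<longrightarrow> x = 0"
    proof (intro ballI impI)
      fix x assume x: "x \<in> span ?D" "f x = 0"
      have "span ?D \<subseteq> V" using C span_mono[of ?D C] by auto
      then have "x \<in> span B" using x B by auto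
      \<comment> \<open>\<open>x\<close> lies in the span of \<open>B\<close> and in that of
        \<open>C - B\<close>, so every coordinate with respect to \<open>C\<close> vanishes for one
        of the two reasons.\<close>
      have "representation C x b = 0" for b
      proof (cases "b \<in> ?D")
        case True
        have "representation C x = representation B x"
          using \<open>x \<in> span B\<close> C by (intro representation_extend) auto
        then show ?thesis using True representation_ne_zero[of B x b] by auto
      next
        case False
        have "representation C x = representation ?D x"
          using x C by (intro representation_extend) auto
        then show ?thesis using False representation_ne_zero[of ?D x b] by auto
      qed
      moreover have "x \<in> span C" using \<open>x \<in> span B\<close> C span_mono by blast
      ultimately show "x = 0"
        using sum_representation_eq[OF C(4) _ C(3) subset_refl, of x] by simp
    qed
  qed
  have "independent ?D" using C independent_mono by blast
  then have ind: "independent (f ` ?D)"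
    using f.independent_injective_image inj by blast
  have "f ` V \<subseteq> span (f ` ?D)"
  proof -
    have "f ` V = span (f ` C)" using f.span_image[of C] C by simp
    also have "\<dots> \<subseteq> span (insert 0 (f ` ?D))"
      using B C by (intro span_mono) auto
    finally show ?thesis by simp
  qed
  moreover have "f ` ?D \<subseteq> f ` V" using C by auto
  ultimately have "dim (f ` V) = card (f ` ?D)" using ind by (intro dim_unique) auto
  also have "\<dots> = card ?D"
    using inj span_superset by (intro card_image) (meson inj_on_subset)
  also have "\<dots> = dim V - dim ?K" using B C by (simp add: card_Diff_subset)
  finally show ?thesis using card_mono[OF C(3,1)] B(5) C(6) by simp
qed

text \<open>Module homomorphisms are linear only on a carrier, whereas \<open>lin\<close> speaks of
  the whole space. The values on a basis of \<open>V\<close> define an extension.\<close>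

lemma linear_extension_from_subspace:
  assumes "subspace V"
    and "\<And>x y. x \<in> V \<Longrightarrow> y \<in> V \<Longrightarrow> g (x + y) = g x + g y"
    and "\<And>c x. x \<in> V \<Longrightarrow> g (scale c x) = scale c (g x)"
  obtains f where "lin f" "\<And>x. x \<in> V \<Longrightarrow> f x = g x"
proof -
  obtain B where B: "B \<subseteq> V" "independent B" "V \<subseteq> span B" 
    using maximal_independent_subset by metis
  let ?f = "endo.construct B g"
  have lin: "lin ?f" using B by (intro endo.linear_construct)
  interpret f: Vector_Spaces.linear scale scale ?f by fact
  have g0: "g 0 = 0" using assms(3)[of 0 0] subspace_0[OF assms(1)] by simp
  have "x \<in> V \<and> ?f x = g x" if "x \<in> span B" for x
    using that
  proof (induction rule: span_induct_alt)
    case base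
    then show ?case using g0 subspace_0[OF assms(1)] by simp
  next
    case (step c x y)
    then have "x \<in> V" "?f x = g x" using B endo.construct_basis by auto
    then show ?case using step assms
      by (simp add: subspace_add subspace_scale f.add f.scale)
  qed
  then show ?thesis using that[OF lin] B by blast
qed

text \<open>A model of the quotient by \<open>K\<close> inside the same space. For a basis
  \<open>C\<close> extending a basis \<open>B\<close> of \<open>K\<close>, \<open>p\<close> kills
  \<open>B\<close> and fixes the rest of \<open>C\<close>.\<close>

lemma projection_along_subspace:
  assumes "subspace K"
  obtains p where "lin p" "\<And>x. p x = 0 \<longleftrightarrow> x \<in> K" "\<And>x. p x - x \<in> K"
proof -
  obtain B where B: "B \<subseteq> K" "independent B" "K \<subseteq> span B"
    using maximal_independent_subset by metis
  have sB: "span B = K" using B assms by (intro span_subspace)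
  obtain C where C: "B \<subseteq> C" "independent C" "UNIV \<subseteq> span C"
    using maximal_independent_subset_extend[of B UNIV] B by auto
  let ?p = "endo.construct C (\<lambda>b. if b \<in> B then 0 else b)"
  have lin: "lin ?p" using C by (intro endo.linear_construct)
  interpret p: Vector_Spaces.linear scale scale ?p by fact
  have pb: "?p b = (if b \<in> B then 0 else b)" if "b \<in> C" for b
    using endo.construct_basis[OF C(2) that] .
  have K: "?p x = 0" if "x \<in> K" for x
  proof (rule p.eq_0_on_span)
    show "x \<in> span B" using that sB by simp
  qed (use pb C in auto)
  have diff: "?p x - x \<in> K" for x
  proof -
    have "x \<in> span C" using C by auto
    then show ?thesis
    proof (induction rule: span_induct_alt)
      case base
      then show ?case using subspace_0[OF assms] by simp
    next
      case (step c x y)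
      have "?p x - x \<in> K"
        using pb[OF step(1)] subspace_0[OF assms] B subspace_neg[OF assms] by auto
      then have "scale c (?p x - x) + (?p y - y) \<in> K"
        using step assms by (intro subspace_add subspace_scale)
      also have "scale c (?p x - x) + (?p y - y) = ?p (scale c x + y) - (scale c x + y)"
        by (simp add: p.add p.scale scale_right_diff_distrib)
      finally show ?case .
    qed
  qed
  have "x \<in> K" if "?p x = 0" for x
    using diff[of x] that subspace_neg[OF assms, of "- x"] by simp
  then show ?thesis using that[OF lin] K diff by blast
qed

end

text \<open>The hypothesis \<open>less\<close> says that the Euler form of the Kronecker quiver is
  positive on the dimension vectors of \<open>Y\<close> and \<open>Z\<close>. The linear system for
  a homomorphism then has more unknowns than equations.\<close>

lemma (in linear_space) exists_nonzero_commuting_maps: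
  assumes sub: "subspace Ys" "subspace Yt" "subspace Zs" "subspace Zt"
    and fin: "fin_dim Ys" "fin_dim Yt" "fin_dim Zs" "fin_dim Zt"
    and lin: "\<And>i. lin (m i)" "\<And>i. lin (m' i)"
    and closed: "\<And>i. m i ` Ys \<subseteq> Yt" "\<And>i. m' i ` Zs \<subseteq> Zt"
    and less: "2 * (dim Ys * dim Zt) < dim Ys * dim Zs + dim Yt * dim Zt"
  obtains f g where "lin f" "lin g" "f ` Ys \<subseteq> Zs" "g ` Yt \<subseteq> Zt"
    "\<And>i :: bool. \<And>x. x \<in> Ys \<Longrightarrow> g (m i x) = m' i (f x)"
    "(\<exists>x\<in>Ys. f x \<noteq> 0) \<or> (\<exists>y\<in>Yt. g y \<noteq> 0)"
proof -
  obtain Bs where Bs: "Bs \<subseteq> Ys" "finite Bs" "independent Bs" "span Bs = Ys" "card Bs = dim Ys"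
    using fin_dim_basis[OF fin(1) sub(1)] .
  obtain Bt where Bt: "Bt \<subseteq> Yt" "finite Bt" "independent Bt" "span Bt = Yt" "card Bt = dim Yt"
    using fin_dim_basis[OF fin(2) sub(2)] .
  obtain Cs where Cs: "Cs \<subseteq> Zs" "finite Cs" "independent Cs" "span Cs = Zs" "card Cs = dim Zs"
    using fin_dim_basis[OF fin(3) sub(3)] .
  obtain Ct where Ct: "Ct \<subseteq> Zt" "finite Ct" "independent Ct" "span Ct = Zt" "card Ct = dim Zt"
    using fin_dim_basis[OF fin(4) sub(4)] .
  \<comment> \<open>The unknowns \<open>X\<close> are the matrix entries of \<open>f\<close> and \<open>g\<close>, the equations \<open>E\<close> are the matrix
    entries of \<open>g \<circ> m i = m' i \<circ> f\<close>.\<close>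
  define X where "X = (Bs \<times> Cs) <+> (Bt \<times> Ct)"
  define E where "E = (UNIV :: bool set) \<times> (Bs \<times> Ct)"
  \<comment> \<open>Row \<open>(i, b, z)\<close> is the coordinate at \<open>z\<close> of
    \<open>g (m i b) - m' i (f b)\<close>: it involves the entries of \<open>f\<close> at
    \<open>b\<close>, with a minus sign, and the entries of \<open>g\<close> with target
    \<open>z\<close>.\<close>
  define A where "A e x = (case e of (i, b, z) \<Rightarrow> case x of
      Inl (b', z') \<Rightarrow> if b' = b then - representation Ct (m' i z') z else 0
    | Inr (b', z') \<Rightarrow> if z' = z then representation Bt (m i b) b' else 0)" for e x
  have "card E < card X"
    using less Bs Bt Cs Ct by (simp add: E_def X_def card_cartesian_product card_Plus)
  moreover have "finite E" "finite X" using Bs Bt Cs Ct by (auto simp: E_def X_def)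
  ultimately obtain c where c: "\<exists>x\<in>X. c x \<noteq> 0" "\<forall>e\<in>E. (\<Sum>x\<in>X. A e x * c x) = 0"
    using homogeneous_system_solution[of E X A] by blast
  define fb where "fb b = (\<Sum>z\<in>Cs. scale (c (Inl (b, z))) z)" for b
  define gb where "gb b = (\<Sum>z\<in>Ct. scale (c (Inr (b, z))) z)" for b
  define f where "f = endo.construct Bs fb"
  define g where "g = endo.construct Bt gb"
  have linf: "lin f" and ling: "lin g"
    unfolding f_def g_def using Bs Bt by (auto intro: endo.linear_construct)
  interpret f: Vector_Spaces.linear scale scale f by (fact linf)
  interpret g: Vector_Spaces.linear scale scale g by (fact ling)
  have f: "f b = fb b" if "b \<in> Bs" for b
    unfolding f_def using endo.construct_basis[OF Bs(3) that] .
  have g: "g b = gb b" if "b \<in> Bt" for b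
    unfolding g_def using endo.construct_basis[OF Bt(3) that] .
  have fZ: "fb b \<in> Zs" for b
    unfolding fb_def using Cs sub by (intro subspace_sum subspace_scale) auto
  have gZ: "gb b \<in> Zt" for b
    unfolding gb_def using Ct sub by (intro subspace_sum subspace_scale) auto
  have "f ` Ys = span (f ` Bs)" using f.span_image[of Bs] Bs by simp
  also have "\<dots> \<subseteq> Zs" using fZ f sub by (intro span_minimal) auto
  finally have fY: "f ` Ys \<subseteq> Zs" .
  have "g ` Yt = span (g ` Bt)" using g.span_image[of Bt] Bt by simp
  also have "\<dots> \<subseteq> Zt" using gZ g sub by (intro span_minimal) auto
  finally have gY: "g ` Yt \<subseteq> Zt" .
  have eq: "(\<Sum>b'\<in>Bt. representation Bt (m i b) b' * c (Inr (b', z))) =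
      (\<Sum>z'\<in>Cs. representation Ct (m' i z') z * c (Inl (b, z')))"
    if bz: "b \<in> Bs" "z \<in> Ct" for i b z
  proof -
    have "0 = (\<Sum>x\<in>X. A (i, b, z) x * c x)" using c(2) bz by (auto simp: E_def)
    also have "\<dots> = (\<Sum>b'\<in>Bs. \<Sum>z'\<in>Cs. A (i, b, z) (Inl (b', z')) * c (Inl (b', z'))) +
        (\<Sum>b'\<in>Bt. \<Sum>z'\<in>Ct. A (i, b, z) (Inr (b', z')) * c (Inr (b', z')))"
      unfolding X_def using Bs Bt Cs Ct by (simp add: sum.Plus sum.cartesian_product o_def case_prod_beta)
    also have "(\<Sum>b'\<in>Bs. \<Sum>z'\<in>Cs. A (i, b, z) (Inl (b', z')) * c (Inl (b', z'))) =
        (\<Sum>b'\<in>Bs. if b' = b then \<Sum>z'\<in>Cs. - representation Ct (m' i z') z * c (Inl (b, z')) else 0)"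
      by (intro sum.cong) (auto simp: A_def)
    also have "\<dots> = - (\<Sum>z'\<in>Cs. representation Ct (m' i z') z * c (Inl (b, z')))"
      using bz Bs by (simp add: sum_negf)
    also have "(\<Sum>b'\<in>Bt. \<Sum>z'\<in>Ct. A (i, b, z) (Inr (b', z')) * c (Inr (b', z'))) =
        (\<Sum>b'\<in>Bt. \<Sum>z'\<in>Ct. if z' = z then representation Bt (m i b) b' * c (Inr (b', z)) else 0)"
      by (intro sum.cong) (auto simp: A_def)
    also have "\<dots> = (\<Sum>b'\<in>Bt. representation Bt (m i b) b' * c (Inr (b', z)))"
      using bz Ct by simp
    finally show ?thesis by simp
  qed
  have comm: "g (m i x) = m' i (f x)" if "x \<in> Ys" for i x
  proof -
    interpret m: Vector_Spaces.linear scale scale "m i" by (fact lin)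
    interpret m': Vector_Spaces.linear scale scale "m' i" by (fact lin)
    have "(g \<circ> m i) x = (m' i \<circ> f) x"
    proof (rule endo.linear_eq_on[where f = "g \<circ> m i" and g = "m' i \<circ> f" and B = Bs])
      show "lin (g \<circ> m i)" using lin(1) ling by (rule Vector_Spaces.linear_compose)
      show "lin (m' i \<circ> f)" using linf lin(2) by (rule Vector_Spaces.linear_compose)
      show "x \<in> span Bs" using that Bs by simp
    next
      fix b assume b: "b \<in> Bs"
      have "m i b \<in> span Bt" using b Bs Bt closed(1) by blast
      then have "g (m i b) = g (\<Sum>b'\<in>Bt. scale (representation Bt (m i b) b') b')"
        using sum_representation_eq[OF Bt(3) _ Bt(2) subset_refl] by simp
      also have "\<dots> = (\<Sum>b'\<in>Bt. scale (representation Bt (m i b) b') (gb b'))"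
        using g by (simp add: g.sum g.scale)
      also have "\<dots> = (\<Sum>b'\<in>Bt. \<Sum>z\<in>Ct. scale (representation Bt (m i b) b' * c (Inr (b', z))) z)"
        by (simp add: gb_def scale_sum_right)
      also have "\<dots> = (\<Sum>z\<in>Ct. \<Sum>b'\<in>Bt. scale (representation Bt (m i b) b' * c (Inr (b', z))) z)"
        by (rule sum.swap)
      also have "\<dots> = (\<Sum>z\<in>Ct. \<Sum>z'\<in>Cs. scale (representation Ct (m' i z') z * c (Inl (b, z'))) z)"
        using eq[OF b] by (simp add: scale_sum_left[symmetric])
      also have "\<dots> = (\<Sum>z'\<in>Cs. \<Sum>z\<in>Ct. scale (representation Ct (m' i z') z * c (Inl (b, z'))) z)"
        by (rule sum.swap)
      also have "\<dots> = (\<Sum>z'\<in>Cs. scale (c (Inl (b, z'))) (\<Sum>z\<in>Ct. scale (representation Ct (m' i z') z) z))"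
        by (simp add: scale_sum_right mult.commute)
      also have "\<dots> = (\<Sum>z'\<in>Cs. scale (c (Inl (b, z'))) (m' i z'))"
      proof (rule sum.cong[OF refl])
        fix z' assume "z' \<in> Cs"
        then have "m' i z' \<in> span Ct" using Cs Ct closed(2) by blast
        then show "scale (c (Inl (b, z'))) (\<Sum>z\<in>Ct. scale (representation Ct (m' i z') z) z) =
            scale (c (Inl (b, z'))) (m' i z')"
          using sum_representation_eq[OF Ct(3) _ Ct(2) subset_refl] by simp
      qed
      also have "\<dots> = m' i (f b)" using f[OF b] by (simp add: fb_def m'.sum m'.scale)
      finally show "(g \<circ> m i) b = (m' i \<circ> f) b" by simp
    qed
    then show ?thesis by simp
  qed
  have "(\<exists>x\<in>Ys. f x \<noteq> 0) \<or> (\<exists>y\<in>Yt. g y \<noteq> 0)"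
  proof (rule ccontr)
    assume not: "\<not> ?thesis"
    \<comment> \<open>By independence of the target bases, maps that vanish have only zero matrix
      entries, against the nontrivial solution \<open>c\<close>.\<close>
    have "c (Inl (b, z)) = 0" if "b \<in> Bs" "z \<in> Cs" for b z
      using that not f[of b] Bs(1) independentD[OF Cs(3,2) subset_refl, of "\<lambda>z. c (Inl (b, z))" z]
      by (auto simp: fb_def)
    moreover have "c (Inr (b, z)) = 0" if "b \<in> Bt" "z \<in> Ct" for b z
      using that not g[of b] Bt(1) independentD[OF Ct(3,2) subset_refl, of "\<lambda>z. c (Inr (b, z))" z]
      by (auto simp: gb_def)
    ultimately show False using c(1) by (auto simp: X_def)
  qed
  then show ?thesis using that[OF linf ling fY gY comm] by blast
qed

section \<open>The sequence space with truncation and shift\<close>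

definition fscale :: "'k::field \<Rightarrow> (nat \<Rightarrow> 'k) \<Rightarrow> nat \<Rightarrow> 'k" where
  "fscale c x = (\<lambda>i. c * x i)"

interpretation seq: linear_space fscale
  by unfold_locales (auto simp: fscale_def algebra_simps)

definition unit_seq :: "nat \<Rightarrow> nat \<Rightarrow> 'k::field" where
  "unit_seq i = (\<lambda>j. if j = i then 1 else 0)"

text \<open>The copy of \<open>k^n\<close> in the sequence space; a single ambient type then serves
  all \<open>n\<close>.\<close>

definition below :: "nat \<Rightarrow> (nat \<Rightarrow> 'k::field) set" where
  "below n = {x. \<forall>i\<ge>n. x i = 0}"

text \<open>On \<open>below (Suc n)\<close> this forgets the last coordinate, while
  \<open>shift\<close> forgets the first: these are the two arrows of the preinjective
  representation of dimension vector \<open>(n + 1, n)\<close>.\<close>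

definition trunc :: "nat \<Rightarrow> (nat \<Rightarrow> 'k::field) \<Rightarrow> nat \<Rightarrow> 'k" where
  "trunc n x = (\<lambda>i. if i < n then x i else 0)"

definition shift :: "(nat \<Rightarrow> 'k::field) \<Rightarrow> nat \<Rightarrow> 'k" where
  "shift x = (\<lambda>i. x (Suc i))"

lemma subspace_below: "seq.subspace (below n)"
  by (auto simp: seq.subspace_def below_def fscale_def)

lemma linear_trunc: "seq.lin (trunc n)" and linear_shift: "seq.lin shift"
  by (auto simp: Vector_Spaces.linear_iff seq.vector_space_axioms trunc_def shift_def fscale_def fun_eq_iff)

lemma sum_fun_apply: "(\<Sum>x\<in>A. f x) i = (\<Sum>x\<in>A. (f x i :: 'k::comm_monoid_add))"
  by (induction A rule: infinite_finite_induct) auto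

lemma below_basis:
  "seq.independent (unit_seq ` {..<n} :: (nat \<Rightarrow> 'k::field) set)"
  "seq.span (unit_seq ` {..<n}) = (below n :: (nat \<Rightarrow> 'k::field) set)"
proof -
  have inj: "inj_on (unit_seq :: nat \<Rightarrow> nat \<Rightarrow> 'k) A" for A
    by (rule inj_onI) (metis unit_seq_def zero_neq_one)
  have sum: "(\<Sum>x\<in>unit_seq ` {..<n}. fscale (u x) x) i = (if i < n then u (unit_seq i) else 0)"
    for u :: "(nat \<Rightarrow> 'k) \<Rightarrow> 'k" and i
  proof -
    have "(\<Sum>x\<in>unit_seq ` {..<n}. fscale (u x) x) i = (\<Sum>j\<in>{..<n}. u (unit_seq j) * unit_seq j i)"
      by (simp add: sum.reindex[OF inj] sum_fun_apply fscale_def)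
    also have "\<dots> = (\<Sum>j\<in>{..<n}. if i = j then u (unit_seq j) else 0)"
      by (intro sum.cong) (auto simp: unit_seq_def)
    finally show ?thesis by simp
  qed
  have False if "seq.dependent (unit_seq ` {..<n} :: (nat \<Rightarrow> 'k) set)"
  proof -
    from that obtain u :: "(nat \<Rightarrow> 'k) \<Rightarrow> 'k" and i
      where u: "i < n" "u (unit_seq i) \<noteq> 0" "(\<Sum>x\<in>unit_seq ` {..<n}. fscale (u x) x) = 0"
      by (subst (asm) seq.dependent_finite) auto
    then show False using sum[of u i] by simp
  qed
  then show "seq.independent (unit_seq ` {..<n} :: (nat \<Rightarrow> 'k) set)" by blast
  show "seq.span (unit_seq ` {..<n}) = (below n :: (nat \<Rightarrow> 'k) set)"
  proof
    show "seq.span (unit_seq ` {..<n}) \<subseteq> (below n :: (nat \<Rightarrow> 'k) set)"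
      by (intro seq.span_minimal subspace_below) (auto simp: below_def unit_seq_def)
    show "(below n :: (nat \<Rightarrow> 'k) set) \<subseteq> seq.span (unit_seq ` {..<n})"
    proof
      fix x :: "nat \<Rightarrow> 'k" assume x: "x \<in> below n"
      \<comment> \<open>\<open>unit_seq\<close> is injective, so its inverse recovers the index of
        the coordinate that serves as coefficient.\<close>
      define u where "u y = x (inv_into UNIV unit_seq y)" for y :: "nat \<Rightarrow> 'k"
      have "x = (\<Sum>y\<in>unit_seq ` {..<n}. fscale (u y) y)"
        using x by (auto simp: sum u_def inv_into_f_f[OF inj] below_def)
      also have "\<dots> \<in> seq.span (unit_seq ` {..<n})"
        by (intro seq.span_sum seq.span_scale seq.span_base)
      finally show "x \<in> seq.span (unit_seq ` {..<n})" .
    qed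
  qed
qed

lemma fin_dim_below: "seq.fin_dim (below n)"
  unfolding seq.fin_dim_def using below_basis(2)[of n] by blast

lemma dim_below: "seq.dim (below n :: (nat \<Rightarrow> 'k::field) set) = n"
proof -
  have "inj_on (unit_seq :: nat \<Rightarrow> nat \<Rightarrow> 'k) {..<n}"
    by (rule inj_onI) (metis unit_seq_def zero_neq_one)
  then show ?thesis
    using seq.dim_span_eq_card_independent[OF below_basis(1)[where 'k = 'k], of n]
    by (simp only: below_basis(2) card_image card_lessThan)
qed

text \<open>The truncation kills at most the line of \<open>unit_seq n\<close>. If that line lies in \<open>U\<close>, then the shift
  compensates for it: if \<open>unit_seq l \<notin> U\<close> and \<open>unit_seq (Suc l) \<in> U\<close>, then
  \<open>unit_seq l\<close> is a shift of an element of \<open>U\<close>, but not a truncation.\<close>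

lemma proper_subspace_dim_le:
  fixes U W :: "(nat \<Rightarrow> 'k::field) set"
  assumes U: "seq.subspace U" "U \<subset> below (Suc n)"
    and W: "seq.subspace W" "seq.fin_dim W" "trunc n ` U \<subseteq> W" "shift ` U \<subseteq> W"
  shows "seq.dim U \<le> seq.dim W"
proof -
  interpret trunc: Vector_Spaces.linear fscale fscale "trunc n :: (nat \<Rightarrow> 'k) \<Rightarrow> _" by (rule linear_trunc)
  let ?K = "{x \<in> U. trunc n x = 0}"
  have finU: "seq.fin_dim U" using U fin_dim_below seq.fin_dim_subset by blast
  have rn: "seq.dim (trunc n ` U) + seq.dim ?K = seq.dim U"
    using seq.rank_nullity[OF finU U(1) linear_trunc] .
  have subT: "seq.subspace (trunc n ` U)" using U(1) by (rule trunc.subspace_image)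
  have dimT: "seq.dim (trunc n ` U) \<le> seq.dim W"
    using seq.fin_dim_dim_mono(1)[OF W(2) subT W(1,3)] .
  have split: "x = trunc n x + fscale (x n) (unit_seq n)" if "x \<in> U" for x
    using that U(2) by (auto simp: trunc_def fscale_def unit_seq_def below_def fun_eq_iff)
  show ?thesis
  proof (cases "unit_seq n \<in> U")
    \<comment> \<open>Truncation is then injective on \<open>U\<close>, and this one map already
      gives the bound.\<close>
    case False
    have "?K \<subseteq> {0}"
    proof
      fix x assume x: "x \<in> ?K"
      then have eq: "x = fscale (x n) (unit_seq n)" using split[of x] by simp
      have "x n = 0"
      proof (rule ccontr)
        assume "x n \<noteq> 0"
        then have "fscale (inverse (x n)) x = unit_seq n"
          by (subst eq) (simp add: fscale_def unit_seq_def fun_eq_iff)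
        then show False using False x seq.subspace_scale[OF U(1)] by (metis (lifting) mem_Collect_eq)
      qed
      then show "x \<in> {0}" using eq by (simp add: fscale_def zero_fun_def)
    qed
    then have "seq.dim ?K = 0" using seq.dim_le_card[of ?K "{}"] by simp
    then show ?thesis using rn dimT by simp
  next
    case True
    \<comment> \<open>Otherwise one could descend from \<open>unit_seq n\<close> through all unit
      vectors, and \<open>U\<close> would be all of \<open>below (Suc n)\<close>.\<close>
    have "\<exists>l<n. unit_seq l \<notin> U \<and> unit_seq (Suc l) \<in> U"
    proof (rule ccontr)
      assume "\<not> ?thesis"
      then have step: "unit_seq (Suc l) \<in> U \<Longrightarrow> unit_seq l \<in> U" if "l < n" for l using that by blast
      have "unit_seq i \<in> U" if "i \<le> n" for i
        using that by (rule inc_induct) (use True step in auto)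
      then have "seq.span (unit_seq ` {..<Suc n}) \<subseteq> U"
        using U(1) by (intro seq.span_minimal) auto
      then show False using U(2) below_basis(2)[where 'k = 'k, of "Suc n"] by blast
    qed
    then obtain l where l: "l < n" "unit_seq l \<notin> U" "unit_seq (Suc l) \<in> U" by blast
    have "shift (unit_seq (Suc l)) = unit_seq l" by (auto simp: shift_def unit_seq_def)
    then have "unit_seq l \<in> W" using l(3) W(4) by (metis image_subset_iff)
    moreover have "unit_seq l \<notin> trunc n ` U"
    proof
      assume "unit_seq l \<in> trunc n ` U"
      then obtain u where u: "u \<in> U" "trunc n u = unit_seq l" by force
      then have "unit_seq l = u - fscale (u n) (unit_seq n)" using split[OF u(1)] by (simp add: algebra_simps)
      then show False
        using l(2) u(1) True U(1) by (metis seq.subspace_diff seq.subspace_scale)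
    qed
    ultimately have "seq.dim (trunc n ` U) \<noteq> seq.dim W"
      using seq.fin_dim_dim_mono(2)[OF W(2) subT W(1,3)] by blast
    moreover have "seq.dim ?K \<le> card {unit_seq n :: nat \<Rightarrow> 'k}"
    proof (rule seq.dim_le_card)
      show "?K \<subseteq> seq.span {unit_seq n}"
        using split by (auto simp: seq.span_singleton) (metis add_0 rangeI)
    qed simp
    ultimately show ?thesis using rn dimT by simp
  qed
qed

section \<open>Torsion classes\<close>

lemma left_module_hom_closed: "f \<in> left_module_hom R M N \<Longrightarrow> x \<in> carrier M \<Longrightarrow> f x \<in> carrier N"
  by (auto simp: left_module_hom_def)

lemma left_module_hom_add:
  "f \<in> left_module_hom R M N \<Longrightarrow> x \<in> carrier M \<Longrightarrow> y \<in> carrier M \<Longrightarrow>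
   f (x \<oplus>\<^bsub>M\<^esub> y) = f x \<oplus>\<^bsub>N\<^esub> f y"
  by (auto simp: left_module_hom_def)

lemma left_module_hom_smult:
  "f \<in> left_module_hom R M N \<Longrightarrow> a \<in> carrier R \<Longrightarrow> x \<in> carrier M \<Longrightarrow>
   f (a \<odot>\<^bsub>M\<^esub> x) = a \<odot>\<^bsub>N\<^esub> f x"
  by (auto simp: left_module_hom_def)

lemma left_module_homI:
  assumes "\<And>x. x \<in> carrier M \<Longrightarrow> f x \<in> carrier N"
    and "\<And>x y. x \<in> carrier M \<Longrightarrow> y \<in> carrier M \<Longrightarrow> f (x \<oplus>\<^bsub>M\<^esub> y) = f x \<oplus>\<^bsub>N\<^esub> f y"
    and "\<And>a x. a \<in> carrier R \<Longrightarrow> x \<in> carrier M \<Longrightarrow> f (a \<odot>\<^bsub>M\<^esub> x) = a \<odot>\<^bsub>N\<^esub> f x"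
  shows "f \<in> left_module_hom R M N"
  using assms by (auto simp: left_module_hom_def)

lemma left_module_hom_comp:
  "f \<in> left_module_hom R L M \<Longrightarrow> g \<in> left_module_hom R M N \<Longrightarrow> g \<circ> f \<in> left_module_hom R L N"
  by (auto simp: left_module_hom_def Pi_iff)

lemma left_module_hom_zero:
  assumes "left_module R M" "left_module R N" "f \<in> left_module_hom R M N"
  shows "f \<zero>\<^bsub>M\<^esub> = \<zero>\<^bsub>N\<^esub>"
proof -
  interpret M: left_module R M by fact
  interpret N: left_module R N by fact
  have "f \<zero>\<^bsub>M\<^esub> \<oplus>\<^bsub>N\<^esub> f \<zero>\<^bsub>M\<^esub> = f \<zero>\<^bsub>M\<^esub>"
    using left_module_hom_add[OF assms(3), of "\<zero>\<^bsub>M\<^esub>" "\<zero>\<^bsub>M\<^esub>"] by simp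
  then show ?thesis
    using left_module_hom_closed[OF assms(3), of "\<zero>\<^bsub>M\<^esub>"] by (metis M.M.zero_closed N.M.add.r_cancel_one')
qed

lemma left_module_hom_inv_into:
  assumes "left_module R M" "f \<in> left_module_hom R M N" "bij_betw f (carrier M) (carrier N)"
  shows "inv_into (carrier M) f \<in> left_module_hom R N M"
    and "bij_betw (inv_into (carrier M) f) (carrier N) (carrier M)"
proof -
  interpret M: left_module R M by fact
  let ?k = "inv_into (carrier M) f"
  show "bij_betw ?k (carrier N) (carrier M)" using assms(3) by (rule bij_betw_inv_into)
  have k: "?k (f x) = x" if "x \<in> carrier M" for x
    using assms(3) that by (simp add: bij_betw_inv_into_left)
  have surj: "\<exists>x\<in>carrier M. y = f x" if "y \<in> carrier N" for y
    using assms(3) that by (auto simp: bij_betw_def)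
  show "?k \<in> left_module_hom R N M"
  proof (rule left_module_homI)
    fix x y assume "x \<in> carrier N" "y \<in> carrier N"
    then obtain x' y' where "x' \<in> carrier M" "x = f x'" "y' \<in> carrier M" "y = f y'" using surj by metis
    then show "?k (x \<oplus>\<^bsub>N\<^esub> y) = ?k x \<oplus>\<^bsub>M\<^esub> ?k y"
      by (simp add: k flip: left_module_hom_add[OF assms(2)])
  next
    fix a x assume "a \<in> carrier R" "x \<in> carrier N"
    moreover obtain x' where "x' \<in> carrier M" "x = f x'" using surj calculation(2) by metis
    ultimately show "?k (a \<odot>\<^bsub>N\<^esub> x) = a \<odot>\<^bsub>M\<^esub> ?k x"
      by (simp add: k flip: left_module_hom_smult[OF assms(2)])
  qed (use surj k in force)
qed

lemma left_module_hom_eqI: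
  assumes "left_module R M" "left_module R N" "f \<in> left_module_hom R M N"
    and "x \<in> carrier M" "y \<in> carrier M" and diff: "f (x \<ominus>\<^bsub>M\<^esub> y) = \<zero>\<^bsub>N\<^esub>"
  shows "f x = f y"
proof -
  interpret M: left_module R M by fact
  interpret N: left_module R N by fact
  have "f x = f ((x \<ominus>\<^bsub>M\<^esub> y) \<oplus>\<^bsub>M\<^esub> y)"
    using assms by (simp add: M.M.minus_eq M.M.a_assoc M.M.l_neg)
  also have "\<dots> = f y"
    using assms by (simp add: left_module_hom_add[OF assms(3)] left_module_hom_closed[OF assms(3)])
  finally show ?thesis .
qed

lemma left_module_hom_diff_eq_zero:
  assumes "left_module R M" "left_module R N" "f \<in> left_module_hom R M N"
    and "x \<in> carrier M" "y \<in> carrier M" "f x = f y"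
  shows "f (x \<ominus>\<^bsub>M\<^esub> y) = \<zero>\<^bsub>N\<^esub>"
proof -
  interpret M: left_module R M by fact
  interpret N: left_module R N by fact
  have "f (x \<ominus>\<^bsub>M\<^esub> y) \<oplus>\<^bsub>N\<^esub> f y = f ((x \<ominus>\<^bsub>M\<^esub> y) \<oplus>\<^bsub>M\<^esub> y)"
    using assms by (simp add: left_module_hom_add[OF assms(3)])
  also have "\<dots> = f y"
    using assms by (simp add: M.M.minus_eq M.M.a_assoc M.M.l_neg)
  finally show ?thesis
    using assms left_module_hom_closed[OF assms(3)] by (metis M.M.minus_closed N.M.add.r_cancel_one)
qed

lemma image_comp_surj: "f ` A = B \<Longrightarrow> g ` B = C \<Longrightarrow> (g \<circ> f) ` A = C"
  by auto

section \<open>Torsion classes and membership up to isomorphism\<close>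

lemma fg_modules_left_module: "M \<in> fg_modules R \<Longrightarrow> left_module R M"
  by (simp add: fg_modules_def)

lemma torsion_class_fg: "torsion_class R T \<Longrightarrow> M \<in> T \<Longrightarrow> M \<in> fg_modules R"
  unfolding torsion_class_def by (elim conjE subsetD)

lemma torsion_class_nonempty: "torsion_class R T \<Longrightarrow> T \<noteq> {}"
  unfolding torsion_class_def by (elim conjE)

lemma torsion_class_quotient:
  "torsion_class R T \<Longrightarrow> M \<in> T \<Longrightarrow> N \<in> fg_modules R \<Longrightarrow> f \<in> left_module_hom R M N \<Longrightarrow>
   f ` carrier M = carrier N \<Longrightarrow> N \<in> T"
  unfolding torsion_class_def by blast

lemma torsion_class_extension:
  "torsion_class R T \<Longrightarrow> L \<in> T \<Longrightarrow> N \<in> T \<Longrightarrow> M \<in> fg_modules R \<Longrightarrow>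
   f \<in> left_module_hom R L M \<Longrightarrow> g \<in> left_module_hom R M N \<Longrightarrow> inj_on f (carrier L) \<Longrightarrow>
   f ` carrier L = a_kernel M N g \<Longrightarrow> g ` carrier M = carrier N \<Longrightarrow> M \<in> T"
  unfolding torsion_class_def by blast

text \<open>Membership in a torsion class for modules over an arbitrary carrier type: as torsion classes
  are closed under quotients, for finitely generated modules this says that the copies in
  \<^const>\<open>fg_modules\<close> belong to the class.\<close>

definition in_class ::
  "('a, 'c) ring_scheme \<Rightarrow> ('a, (nat \<Rightarrow> 'a) set) module set \<Rightarrow> ('a, 'b, 'd) module_scheme \<Rightarrow> bool" where
  "in_class R T M \<longleftrightarrow> (\<exists>N\<in>T. \<exists>f\<in>left_module_hom R N M. f ` carrier N = carrier M)"

lemma in_classI: "N \<in> T \<Longrightarrow> f \<in> left_module_hom R N M \<Longrightarrow> f ` carrier N = carrier M \<Longrightarrow> in_class R T M"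
  by (auto simp: in_class_def)

lemma in_class_mono: "in_class R T M \<Longrightarrow> T \<subseteq> T' \<Longrightarrow> in_class R T' M"
  by (auto simp: in_class_def)

lemma in_class_quotient:
  assumes "in_class R T M" "g \<in> left_module_hom R M N" "g ` carrier M = carrier N"
  shows "in_class R T N"
proof -
  obtain P f where f: "P \<in> T" "f \<in> left_module_hom R P M" "f ` carrier P = carrier M"
    using assms(1) by (auto simp: in_class_def)
  show ?thesis
    using in_classI[OF f(1) left_module_hom_comp[OF f(2) assms(2)] image_comp_surj[OF f(3) assms(3)]] .
qed

text \<open>For a finitely generated module and a torsion class this is equivalent to
  \<open>in_class\<close>. The closure axioms concern actual members of the class, which this form
  provides.\<close>

definition has_copy ::
  "('a, 'c) ring_scheme \<Rightarrow> ('a, (nat \<Rightarrow> 'a) set) module set \<Rightarrow> ('a, 'b, 'd) module_scheme \<Rightarrow> bool" where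
  "has_copy R T M \<longleftrightarrow> (\<exists>N\<in>T. \<exists>f\<in>left_module_hom R M N. bij_betw f (carrier M) (carrier N))"

lemma fg_has_copy: "left_module R M \<Longrightarrow> finitely_generated_module R M \<Longrightarrow> has_copy R (fg_modules R) M"
  using left_module.finitely_generated_module_has_copy[of R M] by (auto simp: has_copy_def)

text \<open>A copy of \<open>M\<close> in \<open>fg_modules\<close> is a quotient of the member of
  \<open>T\<close> that maps onto \<open>M\<close>.\<close>

lemma in_class_has_copy:
  assumes T: "torsion_class R T" and M: "left_module R M" "finitely_generated_module R M"
    and "in_class R T M"
  shows "has_copy R T M"
proof -
  obtain N f where N: "N \<in> fg_modules R" "f \<in> left_module_hom R M N" "bij_betw f (carrier M) (carrier N)"
    using fg_has_copy[OF M] by (auto simp: has_copy_def)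
  obtain P g where P: "P \<in> T" "g \<in> left_module_hom R P M" "g ` carrier P = carrier M"
    using assms(4) by (auto simp: in_class_def)
  have "N \<in> T"
    using torsion_class_quotient[OF T P(1) N(1) left_module_hom_comp[OF P(2) N(2)] image_comp_surj[OF P(3)]] N(3)
    by (simp add: bij_betw_def)
  with N show ?thesis by (auto simp: has_copy_def)
qed

lemma has_copy_in_class:
  assumes "left_module R M" "has_copy R T M"
  shows "in_class R T M"
proof -
  obtain N f where N: "N \<in> T" "f \<in> left_module_hom R M N" "bij_betw f (carrier M) (carrier N)"
    using assms(2) by (auto simp: has_copy_def)
  show ?thesis
    using left_module_hom_inv_into[OF assms(1) N(2,3)] N(1) by (auto simp: in_class_def bij_betw_def)
qed

text \<open>Isomorphisms carry the exact sequence over to copies in \<open>fg_modules\<close>, where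
  closure under extensions applies; the copy of \<open>M\<close> then maps back onto
  \<open>M\<close>.\<close>

lemma in_class_extension:
  assumes T: "torsion_class R T"
    and L: "left_module R L" "finitely_generated_module R L" "in_class R T L"
    and N: "left_module R N" "finitely_generated_module R N" "in_class R T N"
    and M: "left_module R M" "finitely_generated_module R M"
    and f: "f \<in> left_module_hom R L M" "inj_on f (carrier L)"
    and g: "g \<in> left_module_hom R M N" "g ` carrier M = carrier N"
    and exact: "f ` carrier L = {x \<in> carrier M. g x = \<zero>\<^bsub>N\<^esub>}"
  shows "in_class R T M"
proof -
  obtain L' l where L': "L' \<in> T" "l \<in> left_module_hom R L L'" "bij_betw l (carrier L) (carrier L')"
    using in_class_has_copy[OF T L] by (auto simp: has_copy_def)
  obtain N' n where N': "N' \<in> T" "n \<in> left_module_hom R N N'" "bij_betw n (carrier N) (carrier N')"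
    using in_class_has_copy[OF T N] by (auto simp: has_copy_def)
  obtain M' m where M': "M' \<in> fg_modules R" "m \<in> left_module_hom R M M'" "bij_betw m (carrier M) (carrier M')"
    using fg_has_copy[OF M] by (auto simp: has_copy_def)
  interpret M: left_module R M by (rule M(1))
  interpret N: left_module R N by (rule N(1))
  define li where "li = inv_into (carrier L) l"
  define mi where "mi = inv_into (carrier M) m"
  have li: "li \<in> left_module_hom R L' L" "bij_betw li (carrier L') (carrier L)"
    unfolding li_def using left_module_hom_inv_into[OF L(1) L'(2,3)] .
  have mi: "mi \<in> left_module_hom R M' M" "bij_betw mi (carrier M') (carrier M)"
    unfolding mi_def using left_module_hom_inv_into[OF M(1) M'(2,3)] .
  have mim: "mi (m x) = x" if "x \<in> carrier M" for x
    unfolding mi_def using M'(3) that by (simp add: bij_betw_inv_into_left)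
  have mmi: "m (mi x) = x" if "x \<in> carrier M'" for x
    unfolding mi_def using M'(3) that by (simp add: bij_betw_inv_into_right)
  \<comment> \<open>\<open>n\<close> is injective, so composing with it does not enlarge the kernel
    of \<open>g\<close>.\<close>
  have n0: "n x = \<zero>\<^bsub>N'\<^esub> \<longleftrightarrow> x = \<zero>\<^bsub>N\<^esub>" if "x \<in> carrier N" for x
    using left_module_hom_zero[OF N(1) _ N'(2)] torsion_class_fg[OF T N'(1)] N'(3) that
    by (metis N.M.zero_closed bij_betw_imp_inj_on fg_modules_left_module inj_on_eq_iff)
  have "M' \<in> T"
  proof (rule torsion_class_extension[OF T L'(1) N'(1) M'(1)])
    show "m \<circ> f \<circ> li \<in> left_module_hom R L' M'"
      by (intro left_module_hom_comp[OF li(1)] left_module_hom_comp[OF f(1) M'(2)])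
    show "n \<circ> g \<circ> mi \<in> left_module_hom R M' N'"
      by (intro left_module_hom_comp[OF mi(1)] left_module_hom_comp[OF g(1) N'(2)])
    have fc: "f ` carrier L \<subseteq> carrier M" using exact by auto
    have li_img: "li ` carrier L' = carrier L" using li(2) by (simp add: bij_betw_def)
    show "inj_on (m \<circ> f \<circ> li) (carrier L')"
    proof (rule comp_inj_on)
      show "inj_on li (carrier L')" using li(2) by (simp add: bij_betw_def)
      show "inj_on (m \<circ> f) (li ` carrier L')"
        unfolding li_img using inj_on_subset[OF bij_betw_imp_inj_on[OF M'(3)] fc] by (rule comp_inj_on[OF f(2)])
    qed
    show "(n \<circ> g \<circ> mi) ` carrier M' = carrier N'"
      using mi(2) N'(3) by (intro image_comp_surj[OF _ image_comp_surj[OF g(2)]]) (auto simp: bij_betw_def)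
    have "(m \<circ> f \<circ> li) ` carrier L' = m ` {x \<in> carrier M. g x = \<zero>\<^bsub>N\<^esub>}"
      using image_comp_surj[OF li_img image_comp_surj[OF exact refl]] by (simp only: comp_assoc)
    also have "\<dots> = {x \<in> carrier M'. g (mi x) = \<zero>\<^bsub>N\<^esub>}"
    proof (intro equalityI subsetI)
      fix x assume "x \<in> {x \<in> carrier M'. g (mi x) = \<zero>\<^bsub>N\<^esub>}"
      then show "x \<in> m ` {x \<in> carrier M. g x = \<zero>\<^bsub>N\<^esub>}"
        using mmi left_module_hom_closed[OF mi(1)] by (intro image_eqI[of _ _ "mi x"]) auto
    qed (use left_module_hom_closed[OF M'(2)] mim in auto)
    also have "\<dots> = a_kernel M' N' (n \<circ> g \<circ> mi)"
      using n0 left_module_hom_closed[OF g(1)] left_module_hom_closed[OF mi(1)]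
      by (auto simp: a_kernel_def')
    finally show "(m \<circ> f \<circ> li) ` carrier L' = a_kernel M' N' (n \<circ> g \<circ> mi)" .
  qed
  then show ?thesis using mi(1) bij_betw_imp_surj_on[OF mi(2)] by (rule in_classI)
qed

section \<open>Left orthogonal classes and covers\<close>

definition hom_zero :: "('a, 'c) ring_scheme \<Rightarrow> ('a, 'b, 'd) module_scheme \<Rightarrow> ('a, 'm, 'n) module_scheme \<Rightarrow> bool"
  where "hom_zero R M N \<longleftrightarrow> (\<forall>f\<in>left_module_hom R M N. \<forall>x\<in>carrier M. f x = \<zero>\<^bsub>N\<^esub>)"

lemma hom_zero_quotient:
  assumes "hom_zero R M W" "f \<in> left_module_hom R M N" "f ` carrier M = carrier N"
  shows "hom_zero R N W"
  unfolding hom_zero_def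
proof (intro ballI)
  fix h x assume h: "h \<in> left_module_hom R N W" and "x \<in> carrier N"
  then obtain y where y: "y \<in> carrier M" "x = f y" using assms(3) by blast
  then show "h x = \<zero>\<^bsub>W\<^esub>"
    using bspec[OF assms(1)[unfolded hom_zero_def] left_module_hom_comp[OF assms(2) h]] by simp
qed

text \<open>A map from \<open>M\<close> to \<open>W\<close> kills the image of \<open>L\<close>, so
  it factors through \<open>N\<close>, from which only the zero map leads to
  \<open>W\<close>.\<close>

lemma hom_zero_extension:
  assumes mods: "left_module R M" "left_module R N" "left_module R W"
    and zero: "hom_zero R L W" "hom_zero R N W"
    and f: "f \<in> left_module_hom R L M" and g: "g \<in> left_module_hom R M N" "g ` carrier M = carrier N"
    and exact: "f ` carrier L = {x \<in> carrier M. g x = \<zero>\<^bsub>N\<^esub>}"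
  shows "hom_zero R M W"
  unfolding hom_zero_def
proof (intro ballI)
  fix h x assume h: "h \<in> left_module_hom R M W" and x: "x \<in> carrier M"
  interpret M: left_module R M by fact
  have ker: "h y = \<zero>\<^bsub>W\<^esub>" if "y \<in> carrier M" "g y = \<zero>\<^bsub>N\<^esub>" for y
  proof -
    have "y \<in> f ` carrier L" unfolding exact using that by simp
    then obtain z where "z \<in> carrier L" "y = f z" by (rule imageE)
    then show ?thesis
      using bspec[OF zero(1)[unfolded hom_zero_def] left_module_hom_comp[OF f h]] by simp
  qed
  \<comment> \<open>The factorisation, through arbitrary preimages under \<open>g\<close>; the
    choice does not matter because two preimages differ by an element of the kernel of
    \<open>g\<close>.\<close>
  define k where "k = (\<lambda>z. h (inv_into (carrier M) g z))"
  have k: "k (g y) = h y" if y: "y \<in> carrier M" for y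
  proof -
    let ?y = "inv_into (carrier M) g (g y)"
    have y': "?y \<in> carrier M" "g ?y = g y"
      using y by (auto intro: inv_into_into f_inv_into_f)
    have "g (?y \<ominus>\<^bsub>M\<^esub> y) = \<zero>\<^bsub>N\<^esub>"
      using left_module_hom_diff_eq_zero[OF mods(1,2) g(1) y'(1) y y'(2)] .
    then have "h (?y \<ominus>\<^bsub>M\<^esub> y) = \<zero>\<^bsub>W\<^esub>" using ker y y' by blast
    then show ?thesis
      unfolding k_def using left_module_hom_eqI[OF mods(1,3) h y'(1) y] by blast
  qed
  have surj: "\<exists>y\<in>carrier M. z = g y" if "z \<in> carrier N" for z using that g(2) by blast
  have "k \<in> left_module_hom R N W"
  proof (rule left_module_homI)
    fix y assume "y \<in> carrier N"
    then show "k y \<in> carrier W" using surj k left_module_hom_closed[OF h] by metis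
  next
    fix y z assume "y \<in> carrier N" "z \<in> carrier N"
    then obtain y' z' where "y' \<in> carrier M" "y = g y'" "z' \<in> carrier M" "z = g z'" using surj by metis
    then show "k (y \<oplus>\<^bsub>N\<^esub> z) = k y \<oplus>\<^bsub>W\<^esub> k z"
      by (simp add: k left_module_hom_add[OF h] flip: left_module_hom_add[OF g(1)])
  next
    fix a y assume "a \<in> carrier R" "y \<in> carrier N"
    moreover obtain y' where "y' \<in> carrier M" "y = g y'" using surj calculation(2) by metis
    ultimately show "k (a \<odot>\<^bsub>N\<^esub> y) = a \<odot>\<^bsub>W\<^esub> k y"
      by (simp add: k left_module_hom_smult[OF h] flip: left_module_hom_smult[OF g(1)])
  qed
  then show "h x = \<zero>\<^bsub>W\<^esub>"
    using zero(2) k[OF x] left_module_hom_closed[OF g(1) x] by (auto simp: hom_zero_def)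
qed

text \<open>Vanishing of all maps to \<open>W\<close> passes to quotients and extensions, and the
  zero module \<open>Z\<close> makes the class nonempty.\<close>

lemma torsion_class_left_orthogonal:
  assumes T: "torsion_class R T" and W: "left_module R W" and Z: "Z \<in> T" "Z \<in> zero_modules R"
  shows "torsion_class R {M \<in> T. hom_zero R M W}"
  unfolding torsion_class_def
proof (intro conjI ballI impI)
  show "{M \<in> T. hom_zero R M W} \<subseteq> fg_modules R" using torsion_class_fg[OF T] by blast
  have "hom_zero R Z W"
    using left_module_hom_zero[OF fg_modules_left_module W] Z(2)
    by (simp add: hom_zero_def zero_modules_def)
  then show "{M \<in> T. hom_zero R M W} \<noteq> {}" using Z(1) by blast
next
  fix M N
  assume M: "M \<in> {M \<in> T. hom_zero R M W}" and N: "N \<in> fg_modules R"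
    and "\<exists>f\<in>left_module_hom R M N. f ` carrier M = carrier N"
  then obtain f where f: "f \<in> left_module_hom R M N" "f ` carrier M = carrier N" by blast
  show "N \<in> {M \<in> T. hom_zero R M W}"
    using torsion_class_quotient[OF T _ N f] hom_zero_quotient[OF _ f, of W] M by simp
next
  fix L N M
  assume LN: "L \<in> {M \<in> T. hom_zero R M W}" "N \<in> {M \<in> T. hom_zero R M W}" and M: "M \<in> fg_modules R"
    and "\<exists>f\<in>left_module_hom R L M. \<exists>g\<in>left_module_hom R M N.
           inj_on f (carrier L) \<and> f ` carrier L = a_kernel M N g \<and> g ` carrier M = carrier N"
  then obtain f g where fg: "f \<in> left_module_hom R L M" "g \<in> left_module_hom R M N"
    "inj_on f (carrier L)" "f ` carrier L = a_kernel M N g" "g ` carrier M = carrier N" by blast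
  have "M \<in> T" using torsion_class_extension[OF T _ _ M fg] LN by blast
  moreover have "hom_zero R M W"
  proof (rule hom_zero_extension[OF fg_modules_left_module[OF M] _ W _ _ fg(1,2,5)])
    show "left_module R N" using LN torsion_class_fg[OF T] fg_modules_left_module by blast
    show "f ` carrier L = {x \<in> carrier M. g x = \<zero>\<^bsub>N\<^esub>}" using fg(4) by (simp add: a_kernel_def')
  qed (use LN in auto)
  ultimately show "M \<in> {M \<in> T. hom_zero R M W}" by blast
qed

definition torsion_cover ::
  "('a, 'c) ring_scheme \<Rightarrow> ('a, (nat \<Rightarrow> 'a) set) module set \<Rightarrow> ('a, (nat \<Rightarrow> 'a) set) module set \<Rightarrow> bool" where
  "torsion_cover R T T' \<longleftrightarrow> torsion_class R T \<and> torsion_class R T' \<and> T \<subseteq> T' \<and>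
     (\<forall>T''. torsion_class R T'' \<and> T \<subseteq> T'' \<and> T'' \<subseteq> T' \<longrightarrow> T'' = T \<or> T'' = T')"

text \<open>Otherwise the modules in \<open>T'\<close> without nonzero map to \<open>W\<close> would form a torsion class strictly
  between \<open>T\<close> and \<open>T'\<close>: it contains \<open>X\<close>, but not \<open>W\<close>.\<close>

lemma torsion_cover_nonzero_hom:
  assumes cov: "torsion_cover R T T'" and Z: "Z \<in> T" "Z \<in> zero_modules R"
    and W: "left_module R W" "finitely_generated_module R W" "in_class R T' W" "carrier W \<noteq> {\<zero>\<^bsub>W\<^esub>}"
    and X: "left_module R X" "finitely_generated_module R X" "in_class R T' X" "\<not> in_class R T X"
    and zero: "hom_zero R X W"
  obtains (nonzero_hom) Y h y where "Y \<in> T" "h \<in> left_module_hom R Y W" "y \<in> carrier Y" "h y \<noteq> \<zero>\<^bsub>W\<^esub>"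
proof (rule ccontr)
  assume "\<not> thesis"
  then have TW: "hom_zero R Y W" if "Y \<in> T" for Y
  proof (unfold hom_zero_def, intro ballI)
    fix h y assume "h \<in> left_module_hom R Y W" "y \<in> carrier Y"
    then show "h y = \<zero>\<^bsub>W\<^esub>" using \<open>\<not> thesis\<close> nonzero_hom[OF that] by blast
  qed
  have T: "torsion_class R T" "torsion_class R T'" "T \<subseteq> T'"
    and between: "\<And>T''. torsion_class R T'' \<Longrightarrow> T \<subseteq> T'' \<Longrightarrow> T'' \<subseteq> T' \<Longrightarrow> T'' = T \<or> T'' = T'"
    using cov by (auto simp: torsion_cover_def)
  let ?T = "{M \<in> T'. hom_zero R M W}"
  have "?T = T \<or> ?T = T'"
    using torsion_class_left_orthogonal[OF T(2) W(1)] Z T(3) TW by (intro between) auto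
  moreover have "?T \<noteq> T"
  proof -
    obtain N f where N: "N \<in> T'" "f \<in> left_module_hom R X N" "bij_betw f (carrier X) (carrier N)"
      using in_class_has_copy[OF T(2) X(1-3)] by (auto simp: has_copy_def)
    have "hom_zero R N W" using hom_zero_quotient[OF zero N(2)] N(3) by (simp add: bij_betw_def)
    moreover have "N \<notin> T" using has_copy_in_class[OF X(1)] X(4) N(2,3) by (auto simp: has_copy_def)
    ultimately show ?thesis using N(1) by blast
  qed
  moreover have "?T \<noteq> T'"
  proof -
    obtain N f where N: "N \<in> T'" "f \<in> left_module_hom R W N" "bij_betw f (carrier W) (carrier N)"
      using in_class_has_copy[OF T(2) W(1-3)] by (auto simp: has_copy_def)
    interpret W: left_module R W by (rule W(1))
    obtain w where w: "w \<in> carrier W" "w \<noteq> \<zero>\<^bsub>W\<^esub>" using W(4) W.M.zero_closed by blast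
    have "inv_into (carrier W) f (f w) = w" using N(3) w(1) by (simp add: bij_betw_inv_into_left)
    then have "\<not> hom_zero R N W"
      using left_module_hom_inv_into(1)[OF W(1) N(2,3)] w left_module_hom_closed[OF N(2) w(1)]
      unfolding hom_zero_def by metis
    then show ?thesis using N(1) by blast
  qed
  ultimately show False by blast
qed

section \<open>Representations of the Kronecker quiver as modules\<close>

locale ring_character = R?: ring R for R :: "('a, 'c) ring_scheme" (structure) +
  fixes e :: "'a \<Rightarrow> 'k::field"
  assumes e_add: "x \<in> carrier R \<Longrightarrow> y \<in> carrier R \<Longrightarrow> e (x \<oplus> y) = e x + e y"
    and e_mult: "x \<in> carrier R \<Longrightarrow> y \<in> carrier R \<Longrightarrow> e (x \<otimes> y) = e x * e y"
    and e_one: "e \<one> = 1"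
    and e_surj: "\<exists>r\<in>carrier R. e r = k"

text \<open>When \<open>e\<close> is the coefficient of the trivial path at \<open>v\<close>, this
  is the simple module \<open>S\<^sub>v\<close>.\<close>

definition line_module :: "('a \<Rightarrow> 'k::field) \<Rightarrow> ('a, 'k) module" where
  "line_module e = \<lparr>carrier = UNIV, mult = (\<lambda>x y. undefined), one = undefined,
     zero = 0, add = (+), smult = (\<lambda>r x. e r * x)\<rparr>"

lemma line_module_simps [simp]:
  "carrier (line_module e) = UNIV" "\<zero>\<^bsub>line_module e\<^esub> = 0"
  "x \<oplus>\<^bsub>line_module e\<^esub> y = x + y" "r \<odot>\<^bsub>line_module e\<^esub> x = e r * x"
  by (simp_all add: line_module_def)

lemma (in ring_character) line_module: "left_module R (line_module e)"
proof (intro left_module.intro left_module_axioms.intro R.ring_axioms abelian_groupI)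
  fix x :: 'k
  show "\<exists>y\<in>carrier (line_module e). y \<oplus>\<^bsub>line_module e\<^esub> x = \<zero>\<^bsub>line_module e\<^esub>"
    by (auto intro: exI[of _ "- x"])
qed (auto simp: e_add e_mult e_one algebra_simps)

lemma (in ring_character) line_module_fg: "finitely_generated_module R (line_module e)"
  unfolding finitely_generated_module_def
proof (intro exI[of _ "{1}"] conjI allI impI)
  fix N assume N: "submodule N R (line_module e) \<and> {1} \<subseteq> N"
  then interpret submodule N R "line_module e" by blast
  have "x \<in> N" for x
  proof -
    obtain r where "r \<in> carrier R" "e r = x" using e_surj by blast
    then show ?thesis using N smult_closed[of r 1] by simp
  qed
  then show "N = carrier (line_module e)" by auto
qed auto

text \<open>This is the simplicity of \<open>line_module e\<close>: as \<open>e\<close> is onto, one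
  nonzero value can be scaled to every other.\<close>

lemma (in ring_character) nonzero_hom_to_line_surj:
  assumes "left_module R M" "h \<in> left_module_hom R M (line_module e)" "x \<in> carrier M" "h x \<noteq> 0"
  shows "h ` carrier M = carrier (line_module e)"
proof -
  interpret M: left_module R M by fact
  have "y \<in> h ` carrier M" for y
  proof -
    obtain r where r: "r \<in> carrier R" "e r = y / h x" using e_surj by blast
    then have "h (r \<odot>\<^bsub>M\<^esub> x) = y"
      using left_module_hom_smult[OF assms(2) r(1) assms(3)] assms(4) by simp
    then show ?thesis using r(1) assms(3) M.smult_closed by blast
  qed
  then show ?thesis by auto
qed

section \<open>Kronecker representations in sequence space\<close>

lemma seq_subspace_Times_closed:
  "seq.subspace V \<Longrightarrow> seq.subspace W \<Longrightarrow> x \<in> V \<times> W \<Longrightarrow> y \<in> V \<times> W \<Longrightarrow> x + y \<in> V \<times> W"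
  by (auto simp: seq.subspace_add)

text \<open>The two structure maps are defined on the whole sequence space; only their restrictions to \<open>V\<close>
  matter.\<close>

definition is_rep :: "(nat \<Rightarrow> 'k::field) set \<Rightarrow> (nat \<Rightarrow> 'k) set \<Rightarrow> (bool \<Rightarrow> (nat \<Rightarrow> 'k) \<Rightarrow> nat \<Rightarrow> 'k) \<Rightarrow> bool"
  where "is_rep V W m \<longleftrightarrow> seq.subspace V \<and> seq.subspace W \<and> seq.fin_dim V \<and> seq.fin_dim W \<and>
    (\<forall>i. seq.lin (m i)) \<and> (\<forall>i. m i ` V \<subseteq> W)"

lemma is_repD:
  assumes "is_rep V W m"
  shows "seq.subspace V" "seq.subspace W" "seq.fin_dim V" "seq.fin_dim W"
    and "seq.lin (m i)" "x \<in> V \<Longrightarrow> m i x \<in> W"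
  using assms by (auto simp: is_rep_def)

lemma linear_seqD:
  assumes "seq.lin f"
  shows "f (x + y) = f x + f y" "f (fscale c x) = fscale c (f x)" "f 0 = 0" "f (x - y) = f x - f y"
proof -
  interpret Vector_Spaces.linear fscale fscale f by fact
  show "f (x + y) = f x + f y" "f (fscale c x) = fscale c (f x)" "f 0 = 0" "f (x - y) = f x - f y"
    by (fact add scale zero diff)+
qed

text \<open>The functionals that identify a quotient of \<open>R\<close> with the path algebra of the Kronecker quiver
  \<open>s \<rightrightarrows> t\<close>: the coefficients of the two trivial paths and of the two arrows.\<close>

locale kronecker = R?: ring R for R :: "('a, 'c) ring_scheme" (structure) +
  fixes es et :: "'a \<Rightarrow> 'k::field" and c :: "bool \<Rightarrow> 'a \<Rightarrow> 'k"
  assumes f_add: "x \<in> carrier R \<Longrightarrow> y \<in> carrier R \<Longrightarrow>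
      es (x \<oplus> y) = es x + es y \<and> et (x \<oplus> y) = et x + et y \<and> c i (x \<oplus> y) = c i x + c i y"
    and f_mult: "x \<in> carrier R \<Longrightarrow> y \<in> carrier R \<Longrightarrow>
      es (x \<otimes> y) = es x * es y \<and> et (x \<otimes> y) = et x * et y \<and>
      c i (x \<otimes> y) = c i x * es y + et x * c i y"
    and f_one: "es \<one> = 1" "et \<one> = 1" "c i \<one> = 0"
    and f_surj: "\<exists>r\<in>carrier R. es r = k \<and> et r = l \<and> (\<forall>i. c i r = d i)"
begin

sublocale es: ring_character R es
  using f_surj by unfold_locales (auto simp: f_add f_mult f_one, metis)

sublocale et: ring_character R et
  using f_surj by unfold_locales (auto simp: f_add f_mult f_one, metis)

text \<open>An element \<open>r\<close> acts on (component at \<open>s\<close>, component at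
  \<open>t\<close>) as a lower triangular matrix with diagonal \<open>es r\<close>,
  \<open>et r\<close>, where \<open>c i r\<close> is the weight of arrow \<open>i\<close>.\<close>

definition rep :: "(nat \<Rightarrow> 'k) set \<Rightarrow> (nat \<Rightarrow> 'k) set \<Rightarrow> (bool \<Rightarrow> (nat \<Rightarrow> 'k) \<Rightarrow> nat \<Rightarrow> 'k) \<Rightarrow>
    ('a, (nat \<Rightarrow> 'k) \<times> (nat \<Rightarrow> 'k)) module" where
  "rep V W m = \<lparr>carrier = V \<times> W, mult = (\<lambda>x y. undefined), one = undefined, zero = 0, add = (+),
     smult = (\<lambda>r (x, y). (fscale (es r) x,
       fscale (et r) y + fscale (c False r) (m False x) + fscale (c True r) (m True x)))\<rparr>"

lemma rep_simps [simp]: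
  "carrier (rep V W m) = V \<times> W" "\<zero>\<^bsub>rep V W m\<^esub> = 0" "u \<oplus>\<^bsub>rep V W m\<^esub> v = u + v"
  "r \<odot>\<^bsub>rep V W m\<^esub> (x, y) = (fscale (es r) x,
     fscale (et r) y + fscale (c False r) (m False x) + fscale (c True r) (m True x))"
  by (simp_all add: rep_def)

lemma rep_module:
  assumes rep: "is_rep V W m"
  shows "left_module R (rep V W m)"
proof (intro left_module.intro left_module_axioms.intro R.ring_axioms abelian_groupI)
  note D = is_repD[OF rep]
  note m = linear_seqD[OF D(5)]
  fix x assume x: "x \<in> carrier (rep V W m)"
  then have "- x \<in> carrier (rep V W m)" using D seq.subspace_neg by auto
  then show "\<exists>y\<in>carrier (rep V W m). y \<oplus>\<^bsub>rep V W m\<^esub> x = \<zero>\<^bsub>rep V W m\<^esub>"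
    by (intro bexI[of _ "- x"]) auto
  show "\<one> \<odot>\<^bsub>rep V W m\<^esub> x = x"
    by (cases x) (simp add: f_one)
  fix a assume a: "a \<in> carrier R"
  show "a \<odot>\<^bsub>rep V W m\<^esub> x \<in> carrier (rep V W m)"
    using x D by (auto intro!: seq.subspace_add seq.subspace_scale)
  fix y assume y: "y \<in> carrier (rep V W m)"
  show "a \<odot>\<^bsub>rep V W m\<^esub> (x \<oplus>\<^bsub>rep V W m\<^esub> y) =
      a \<odot>\<^bsub>rep V W m\<^esub> x \<oplus>\<^bsub>rep V W m\<^esub> a \<odot>\<^bsub>rep V W m\<^esub> y"
    by (cases x; cases y) (simp add: m seq.scale_right_distrib)
next
  note D = is_repD[OF rep]
  note m = linear_seqD[OF D(5)]
  fix a b x assume a: "a \<in> carrier R" "b \<in> carrier R"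
  show "(a \<oplus> b) \<odot>\<^bsub>rep V W m\<^esub> x = a \<odot>\<^bsub>rep V W m\<^esub> x \<oplus>\<^bsub>rep V W m\<^esub> b \<odot>\<^bsub>rep V W m\<^esub> x"
    using a by (cases x) (simp add: f_add seq.scale_left_distrib)
  show "(a \<otimes> b) \<odot>\<^bsub>rep V W m\<^esub> x = a \<odot>\<^bsub>rep V W m\<^esub> (b \<odot>\<^bsub>rep V W m\<^esub> x)"
    using a by (cases x) (simp add: f_mult m seq.scale_left_distrib seq.scale_right_distrib mult.commute add_ac)
qed (use is_repD[OF rep] in \<open>auto intro: seq_subspace_Times_closed seq.subspace_0 simp: add_ac zero_prod_def\<close>)

text \<open>Ring elements that act as the idempotents at \<open>s\<close> and \<open>t\<close> split
  \<open>Y\<close> into two components, and those that act as the arrows make the components a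
  subrepresentation. The form with sets covers submodules, images and kernels alike.\<close>

lemma closed_subset_rep:
  assumes rep: "is_rep V W m" and Y: "Y \<subseteq> V \<times> W" "0 \<in> Y"
    and add: "\<And>u v. u \<in> Y \<Longrightarrow> v \<in> Y \<Longrightarrow> u + v \<in> Y"
    and smult: "\<And>r u. r \<in> carrier R \<Longrightarrow> u \<in> Y \<Longrightarrow> r \<odot>\<^bsub>rep V W m\<^esub> u \<in> Y"
  obtains Vs Vt where "is_rep Vs Vt m" "Vs \<subseteq> V" "Vt \<subseteq> W" "Y = Vs \<times> Vt"
proof -
  note D = is_repD[OF rep]
  note m = linear_seqD[OF D(5)]
  define Vs where "Vs = {x. (x, 0) \<in> Y}"
  define Vt where "Vt = {y. (0, y) \<in> Y}"
  \<comment> \<open>By \<open>f_surj\<close> every triangular matrix of this shape is the action of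
    some ring element.\<close>
  have act: "(fscale k x, fscale l y + fscale (d False) (m False x) + fscale (d True) (m True x)) \<in> Y"
    if "(x, y) \<in> Y" for k l d x y
  proof -
    obtain r where "r \<in> carrier R" "es r = k" "et r = l" "\<And>i. c i r = d i" using f_surj by metis
    then show ?thesis using smult[of r "(x, y)"] that by simp
  qed
  have s: "(fscale k x, 0) \<in> Y" if "(x, y) \<in> Y" for k x y
    using act[OF that, of k 0 "\<lambda>_. 0"] by simp
  have t: "(0, fscale l y) \<in> Y" if "(x, y) \<in> Y" for l x y
    using act[OF that, of 0 l "\<lambda>_. 0"] by simp
  have sub: "Vs \<subseteq> V" "Vt \<subseteq> W" using Y(1) by (auto simp: Vs_def Vt_def)
  have "is_rep Vs Vt m"
    unfolding is_rep_def
  proof (intro conjI allI)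
    show "seq.subspace Vs" using Y(2) add s by (force simp: seq.subspace_def Vs_def zero_prod_def)
    show "seq.subspace Vt" using Y(2) add t by (force simp: seq.subspace_def Vt_def zero_prod_def)
    show "seq.fin_dim Vs" "seq.fin_dim Vt" using sub D(3,4) seq.fin_dim_subset by blast+
    show "seq.lin (m i)" for i by (rule D(5))
    show "m i ` Vs \<subseteq> Vt" for i
    proof
      fix y assume "y \<in> m i ` Vs"
      then obtain x where "(x, 0) \<in> Y" "y = m i x" by (auto simp: Vs_def)
      then show "y \<in> Vt"
        using act[of x 0 0 0 "\<lambda>j. if j = i then 1 else 0"] by (cases i) (auto simp: Vt_def)
    qed
  qed
  moreover have "Y = Vs \<times> Vt"
  proof (intro equalityI subsetI)
    fix u assume "u \<in> Y"
    then show "u \<in> Vs \<times> Vt" using s[of _ _ 1] t[of _ _ 1] by (cases u) (auto simp: Vs_def Vt_def)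
  next
    fix u assume "u \<in> Vs \<times> Vt"
    then show "u \<in> Y" using add[of "(fst u, 0)" "(0, snd u)"] by (cases u) (auto simp: Vs_def Vt_def)
  qed
  ultimately show ?thesis using that sub by blast
qed

text \<open>Spanning sets at the two vertices generate, since a submodule containing them has the
  form \<open>Vs \<times> Vt\<close> by \<open>closed_subset_rep\<close>.\<close>

lemma rep_fg:
  assumes rep: "is_rep V W m"
  shows "finitely_generated_module R (rep V W m)"
proof -
  note D = is_repD[OF rep]
  obtain B where B: "B \<subseteq> V" "finite B" "seq.span B = V" using seq.fin_dim_basis[OF D(3,1)] .
  obtain C where C: "C \<subseteq> W" "finite C" "seq.span C = W" using seq.fin_dim_basis[OF D(4,2)] .
  have "N = V \<times> W" if N: "submodule N R (rep V W m)" "B \<times> {0} \<union> {0} \<times> C \<subseteq> N" for N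
  proof -
    interpret N: submodule N R "rep V W m" by (rule N(1))
    obtain Vs Vt where V: "is_rep Vs Vt m" "Vs \<subseteq> V" "Vt \<subseteq> W" "N = Vs \<times> Vt"
    proof (rule closed_subset_rep[OF rep])
      show "N \<subseteq> V \<times> W" "0 \<in> N" using N.subset N.one_closed by auto
      show "u + v \<in> N" if "u \<in> N" "v \<in> N" for u v using N.m_closed[OF that] by simp
      show "r \<odot>\<^bsub>rep V W m\<^esub> u \<in> N" if "r \<in> carrier R" "u \<in> N" for r u using N.smult_closed[OF that] .
    qed
    have "V \<subseteq> Vs" unfolding B(3)[symmetric]
      using N(2) V(4) is_repD(1)[OF V(1)] by (intro seq.span_minimal) auto
    moreover have "W \<subseteq> Vt" unfolding C(3)[symmetric]
      using N(2) V(4) is_repD(2)[OF V(1)] by (intro seq.span_minimal) auto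
    ultimately show ?thesis using V by blast
  qed
  then show ?thesis
    unfolding finitely_generated_module_def
    using B C seq.subspace_0[OF D(1)] seq.subspace_0[OF D(2)]
    by (intro exI[of _ "B \<times> {0} \<union> {0} \<times> C"]) auto
qed

lemma rep_hom:
  assumes "seq.lin f" "seq.lin g" "f ` V \<subseteq> V'" "g ` W \<subseteq> W'"
    and "\<And>i x. x \<in> V \<Longrightarrow> m i x \<in> W" "\<And>i x. x \<in> V \<Longrightarrow> g (m i x) = m' i (f x)"
  shows "(\<lambda>(x, y). (f x, g y)) \<in> left_module_hom R (rep V W m) (rep V' W' m')"
  using assms(3-) by (intro left_module_homI) (auto simp: linear_seqD[OF assms(1)] linear_seqD[OF assms(2)])

lemma image_Times: "(\<lambda>(x, y). (f x, g y)) ` (V \<times> W) = (f ` V) \<times> (g ` W)"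
  by auto

lemma image_hom_rep:
  assumes rep: "is_rep V W m" and M: "left_module R M" and h: "h \<in> left_module_hom R M (rep V W m)"
  obtains Vs Vt where "is_rep Vs Vt m" "Vs \<subseteq> V" "Vt \<subseteq> W" "h ` carrier M = Vs \<times> Vt"
    "h \<in> left_module_hom R M (rep Vs Vt m)"
proof -
  interpret M: left_module R M by (rule M)
  obtain Vs Vt where V: "is_rep Vs Vt m" "Vs \<subseteq> V" "Vt \<subseteq> W" "h ` carrier M = Vs \<times> Vt"
  proof (rule closed_subset_rep[OF rep])
    show "h ` carrier M \<subseteq> V \<times> W" using left_module_hom_closed[OF h] by (intro image_subsetI) simp
    have "h \<zero>\<^bsub>M\<^esub> = 0" using left_module_hom_zero[OF M rep_module[OF rep] h] by simp
    then show "0 \<in> h ` carrier M" by (metis M.M.zero_closed imageI)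
    fix u assume "u \<in> h ` carrier M"
    then obtain x where x: "x \<in> carrier M" "u = h x" by blast
    show "u + v \<in> h ` carrier M" if "v \<in> h ` carrier M" for v
    proof -
      from that obtain y where y: "v = h y" "y \<in> carrier M" by (rule imageE)
      have "u + v = h (x \<oplus>\<^bsub>M\<^esub> y)"
        unfolding x(2) y(1) left_module_hom_add[OF h x(1) y(2)] by simp
      then show ?thesis using x(1) y(2) by (auto intro: image_eqI)
    qed
    show "r \<odot>\<^bsub>rep V W m\<^esub> u \<in> h ` carrier M" if "r \<in> carrier R" for r
      unfolding x(2) left_module_hom_smult[OF h that x(1), symmetric]
      using M.smult_closed[OF that x(1)] by (rule imageI)
  qed
  moreover have "h \<in> left_module_hom R M (rep Vs Vt m)"
    using h V(4) by (auto simp: left_module_hom_def rep_def)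
  ultimately show ?thesis using that by blast
qed

lemma kernel_hom_rep:
  assumes rep: "is_rep V W m" and M: "left_module R M" and h: "h \<in> left_module_hom R (rep V W m) M"
  obtains Vs Vt where "is_rep Vs Vt m" "Vs \<subseteq> V" "Vt \<subseteq> W"
    "{u \<in> V \<times> W. h u = \<zero>\<^bsub>M\<^esub>} = Vs \<times> Vt"
proof (rule closed_subset_rep[OF rep, of "{u \<in> V \<times> W. h u = \<zero>\<^bsub>M\<^esub>}"])
  interpret M: left_module R M by (rule M)
  interpret V: left_module R "rep V W m" by (rule rep_module[OF rep])
  show "{u \<in> V \<times> W. h u = \<zero>\<^bsub>M\<^esub>} \<subseteq> V \<times> W" by blast
  show "0 \<in> {u \<in> V \<times> W. h u = \<zero>\<^bsub>M\<^esub>}"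
    using left_module_hom_zero[OF rep_module[OF rep] M h] V.M.zero_closed by simp
  fix u assume u: "u \<in> {u \<in> V \<times> W. h u = \<zero>\<^bsub>M\<^esub>}"
  show "u + v \<in> {u \<in> V \<times> W. h u = \<zero>\<^bsub>M\<^esub>}" if "v \<in> {u \<in> V \<times> W. h u = \<zero>\<^bsub>M\<^esub>}" for v
    using left_module_hom_add[OF h, of u v] u that V.M.a_closed[of u v] by simp
  show "r \<odot>\<^bsub>rep V W m\<^esub> u \<in> {u \<in> V \<times> W. h u = \<zero>\<^bsub>M\<^esub>}" if "r \<in> carrier R" for r
  proof -
    have "r \<odot>\<^bsub>M\<^esub> \<zero>\<^bsub>M\<^esub> = \<zero>\<^bsub>M\<^esub>"
      using M.smult_r_distr[OF that, of "\<zero>\<^bsub>M\<^esub>" "\<zero>\<^bsub>M\<^esub>"] that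
      by (metis M.M.add.r_cancel_one' M.M.r_zero M.M.zero_closed M.smult_closed)
    then show ?thesis
      using left_module_hom_smult[OF h that, of u] u V.smult_closed[OF that, of u] by simp
  qed
qed (use that in blast)

lemma rep_extension:
  assumes T: "torsion_class R T" and rep: "is_rep V W m" "is_rep V' W' m" "V' \<subseteq> V" "W' \<subseteq> W"
    and N: "left_module R N" "finitely_generated_module R N" "in_class R T N"
    and g: "g \<in> left_module_hom R (rep V W m) N" "g ` (V \<times> W) = carrier N"
    and ker: "{u \<in> V \<times> W. g u = \<zero>\<^bsub>N\<^esub>} = V' \<times> W'"
    and V': "in_class R T (rep V' W' m)"
  shows "in_class R T (rep V W m)"
proof (rule in_class_extension[OF T rep_module[OF rep(2)] rep_fg[OF rep(2)] V' N
      rep_module[OF rep(1)] rep_fg[OF rep(1)]])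
  show "id \<in> left_module_hom R (rep V' W' m) (rep V W m)"
    using rep(3,4) by (intro left_module_homI) auto
qed (use g ker in auto)

text \<open>The quotient by a subrepresentation is again placed in sequence space, as the image
  under projections with kernels \<open>Ks\<close> and \<open>Kt\<close>.\<close>

lemma rep_quotient:
  assumes rep: "is_rep V W m" and K: "is_rep Ks Kt m" "Ks \<subseteq> V" "Kt \<subseteq> W"
  obtains p q where "seq.lin p" "seq.lin q" "\<And>x. p x = 0 \<longleftrightarrow> x \<in> Ks" "\<And>x. q x = 0 \<longleftrightarrow> x \<in> Kt"
    "is_rep (p ` V) (q ` W) (\<lambda>i. q \<circ> m i)" "\<And>i x. (q \<circ> m i) (p x) = q (m i x)"
proof -
  note D = is_repD[OF rep]
  obtain p where p: "seq.lin p" "\<And>x. p x = 0 \<longleftrightarrow> x \<in> Ks" "\<And>x. p x - x \<in> Ks"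
    using seq.projection_along_subspace[OF is_repD(1)[OF K(1)]] by blast
  obtain q where q: "seq.lin q" "\<And>x. q x = 0 \<longleftrightarrow> x \<in> Kt" "\<And>x. q x - x \<in> Kt"
    using seq.projection_along_subspace[OF is_repD(2)[OF K(1)]] by blast
  interpret p: Vector_Spaces.linear fscale fscale p by (rule p(1))
  interpret q: Vector_Spaces.linear fscale fscale q by (rule q(1))
  have comm: "(q \<circ> m i) (p x) = q (m i x)" for i x
  proof -
    \<comment> \<open>\<open>p x\<close> and \<open>x\<close> differ by an element of
      \<open>Ks\<close>, which \<open>m i\<close> carries into \<open>Kt\<close>, the kernel of
      \<open>q\<close>.\<close>
    have "q (m i (p x - x)) = 0" using q(2) p(3) is_repD(6)[OF K(1)] by blast
    then show ?thesis by (simp add: linear_seqD[OF D(5)] q.diff)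
  qed
  have "is_rep (p ` V) (q ` W) (\<lambda>i. q \<circ> m i)"
    unfolding is_rep_def
  proof (intro conjI allI)
    show "seq.subspace (p ` V)" "seq.subspace (q ` W)"
      using D p.subspace_image q.subspace_image by blast+
    show "seq.fin_dim (p ` V)" "seq.fin_dim (q ` W)" using D p q seq.fin_dim_image by blast+
    show "seq.lin (q \<circ> m i)" for i using D(5) q(1) by (rule Vector_Spaces.linear_compose)
    show "(q \<circ> m i) ` p ` V \<subseteq> q ` W" for i using comm D(6) by fastforce
  qed
  then show ?thesis using that p(1,2) q(1,2) comm by blast
qed

end

context kronecker
begin

section \<open>The preinjective modules\<close>

definition preinj_maps :: "nat \<Rightarrow> bool \<Rightarrow> (nat \<Rightarrow> 'k) \<Rightarrow> nat \<Rightarrow> 'k" where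
  "preinj_maps n i = (if i then shift else trunc n)"

definition preinj :: "nat \<Rightarrow> ('a, (nat \<Rightarrow> 'k) \<times> (nat \<Rightarrow> 'k)) module" where
  "preinj n = rep (below (Suc n)) (below n) (preinj_maps n)"

lemma is_rep_below: "j \<le> Suc n \<Longrightarrow> is_rep (below j) (below n) (preinj_maps n)"
  unfolding is_rep_def
proof (intro conjI allI subspace_below fin_dim_below)
  show "seq.lin (preinj_maps n i)" for i by (simp add: preinj_maps_def linear_trunc linear_shift)
  show "j \<le> Suc n \<Longrightarrow> preinj_maps n i ` below j \<subseteq> below n" for i
    by (auto simp: preinj_maps_def below_def shift_def trunc_def)
qed

lemma preinj_maps_zero: "preinj_maps n i 0 = 0"
  using linear_seqD(3)[OF is_repD(5)[OF is_rep_below[of 0 n]]] by simp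

lemma preinj_module: "left_module R (preinj n)" and preinj_fg: "finitely_generated_module R (preinj n)"
  unfolding preinj_def using rep_module rep_fg is_rep_below by blast+

lemma below_zero: "below 0 = {0}"
  by (auto simp: below_def)

lemma below_iff_below_Suc: "x \<in> below l \<longleftrightarrow> x \<in> below (Suc l) \<and> x l = 0"
  by (auto simp: below_def) (metis le_antisym not_less_eq_eq)

text \<open>The representation is built one coordinate at a time: first the \<open>n\<close>
  coordinates at \<open>t\<close>, each an extension by \<open>line_module et\<close>, then the
  \<open>j\<close> coordinates at \<open>s\<close>, each an extension by
  \<open>line_module es\<close>.\<close>

lemma in_class_rep_below:
  assumes T: "torsion_class R T" and s: "in_class R T (line_module es)" and t: "in_class R T (line_module et)"
    and "j \<le> Suc n"
  shows "in_class R T (rep (below j) (below n) (preinj_maps n))"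
proof -
  have start: "in_class R T (rep (below 0) (below l) (preinj_maps n))" if "l \<le> n" for l
    using that
  proof (induction l)
    case 0
    \<comment> \<open>The carrier is zero, so the zero map from \<open>line_module es\<close> is
      onto.\<close>
    show ?case
      by (rule in_class_quotient[OF s, of "\<lambda>_. 0"])
        (auto intro!: left_module_homI simp: below_zero zero_prod_def preinj_maps_zero)
  next
    case (Suc l)
    have rep: "is_rep (below 0) (below l) (preinj_maps n)" for l
      unfolding is_rep_def below_zero
      using is_repD(5)[OF is_rep_below[of 0 n]] seq.subspace_0[OF subspace_below, of l]
        subspace_below[of 0] fin_dim_below[of 0]
      by (auto simp: subspace_below fin_dim_below below_zero preinj_maps_zero)
    show ?case
    proof (rule rep_extension[where g = "\<lambda>(x, y). y l" and V' = "below 0" and W' = "below l", OF T rep rep _ _ et.line_module et.line_module_fg t])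
      show "(\<lambda>(x, y). y l) \<in> left_module_hom R (rep (below 0) (below (Suc l)) (preinj_maps n)) (line_module et)"
        by (intro left_module_homI) (auto simp: below_zero preinj_maps_zero fscale_def)
      have "k = (case (0, fscale k (unit_seq l)) of (x, y) \<Rightarrow> y l) \<and>
          (0, fscale k (unit_seq l)) \<in> below 0 \<times> below (Suc l)" for k
        by (auto simp: below_def fscale_def unit_seq_def)
      then show "(\<lambda>(x, y). y l) ` (below 0 \<times> below (Suc l)) = carrier (line_module et)"
        unfolding line_module_simps by blast
      show "{u \<in> below 0 \<times> below (Suc l). (case u of (x, y) \<Rightarrow> y l) = \<zero>\<^bsub>line_module et\<^esub>} =
          below 0 \<times> below l"
        by (auto simp: below_iff_below_Suc[of _ l])
    qed (use Suc in \<open>auto simp: below_def\<close>)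
  qed
  from assms(4) show ?thesis
  proof (induction j)
    case 0
    then show ?case using start by simp
  next
    case (Suc j)
    show ?case
    \<comment> \<open>Reading off coordinate \<open>j\<close> at \<open>s\<close> is a homomorphism
      because no arrow ends at \<open>s\<close>; its kernel is the previous stage.\<close>
    proof (rule rep_extension[where g = "\<lambda>(x, y). x j" and V' = "below j" and W' = "below n", OF T is_rep_below is_rep_below _ _ es.line_module es.line_module_fg s])
      show "(\<lambda>(x, y). x j) \<in> left_module_hom R (rep (below (Suc j)) (below n) (preinj_maps n)) (line_module es)"
        by (intro left_module_homI) (auto simp: fscale_def)
      have "k = (case (fscale k (unit_seq j), 0) of (x, y) \<Rightarrow> x j) \<and>
          (fscale k (unit_seq j), 0) \<in> below (Suc j) \<times> below n" for k
        by (auto simp: below_def fscale_def unit_seq_def)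
      then show "(\<lambda>(x, y). x j) ` (below (Suc j) \<times> below n) = carrier (line_module es)"
        unfolding line_module_simps by blast
      show "{u \<in> below (Suc j) \<times> below n. (case u of (x, y) \<Rightarrow> x j) = \<zero>\<^bsub>line_module es\<^esub>} =
          below j \<times> below n"
        by (auto simp: below_iff_below_Suc[of _ j])
    qed (use Suc in \<open>auto simp: below_def\<close>)
  qed
qed

lemma in_class_preinj:
  "torsion_class R T \<Longrightarrow> in_class R T (line_module es) \<Longrightarrow> in_class R T (line_module et) \<Longrightarrow>
   in_class R T (preinj n)"
  unfolding preinj_def by (rule in_class_rep_below) auto

text \<open>Forgetting the first coordinate at both vertices commutes with both arrows and maps
  \<open>preinj (Suc n)\<close> onto \<open>preinj n\<close>.\<close>

lemma in_class_preinj_Suc: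
  assumes "in_class R T (preinj (Suc n))"
  shows "in_class R T (preinj n)"
proof (rule in_class_quotient[OF assms])
  have surj: "shift ` below (Suc l) = (below l :: (nat \<Rightarrow> 'k) set)" for l
  proof (intro equalityI subsetI)
    fix x :: "nat \<Rightarrow> 'k" assume "x \<in> below l"
    \<comment> \<open>Prepending a zero gives a preimage.\<close>
    then show "x \<in> shift ` below (Suc l)"
      by (intro image_eqI[of _ _ "case_nat 0 x"]) (auto simp: shift_def below_def split: nat.split)
  qed (auto simp: shift_def below_def)
  show "(\<lambda>(x, y). (shift x, shift y)) \<in> left_module_hom R (preinj (Suc n)) (preinj n)"
    unfolding preinj_def
  proof (intro rep_hom linear_shift)
    show "preinj_maps (Suc n) i x \<in> below (Suc n)" if "x \<in> below (Suc (Suc n))" for i x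
      using is_repD(6)[OF is_rep_below that] by simp
    show "shift (preinj_maps (Suc n) i x) = preinj_maps n i (shift x)" for i x
      by (auto simp: preinj_maps_def shift_def trunc_def)
  qed (simp_all add: surj)
  show "(\<lambda>(x, y). (shift x, shift y)) ` carrier (preinj (Suc n)) = carrier (preinj n)"
    by (simp add: preinj_def image_Times surj)
qed

section \<open>Proper submodules of preinjective modules\<close>

lemma trunc_below: "trunc n ` below (Suc n) = below n"
proof (intro equalityI subsetI)
  fix x :: "nat \<Rightarrow> 'b" assume "x \<in> below n"
  then show "x \<in> trunc n ` below (Suc n)"
    by (intro image_eqI[of _ _ x]) (auto simp: trunc_def below_def)
qed (auto simp: trunc_def below_def)

text \<open>\<open>trunc n\<close> maps onto \<open>below n\<close>, so a subrepresentation that is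
  full at \<open>s\<close> is full at \<open>t\<close> too. A proper one is therefore proper at
  \<open>s\<close>, where \<open>proper_subspace_dim_le\<close> applies.\<close>

lemma proper_subrep_dim_le:
  assumes rep: "is_rep Vs Vt (preinj_maps n)" "Vs \<subseteq> below (Suc n)" "Vt \<subseteq> below n"
    and proper: "Vs \<times> Vt \<noteq> below (Suc n) \<times> below n"
  shows "seq.dim Vs \<le> seq.dim Vt"
proof -
  have img: "trunc n ` Vs \<subseteq> Vt" "shift ` Vs \<subseteq> Vt"
    using is_repD(6)[OF rep(1), of _ False] is_repD(6)[OF rep(1), of _ True]
    by (auto simp: preinj_maps_def)
  have "Vs \<noteq> below (Suc n)"
  proof
    assume Vs: "Vs = below (Suc n)"
    then have "Vt = below n" using img(1) rep(3) by (simp add: trunc_below)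
    with Vs proper show False by simp
  qed
  then show ?thesis
    using proper_subspace_dim_le[OF is_repD(1)[OF rep(1)] _ is_repD(2,4)[OF rep(1)] img] rep(2) by blast
qed

text \<open>The kernel and the image of a nonzero map would both be proper submodules, hence have at \<open>s\<close> at
  most the dimension that they have at \<open>t\<close>; but for \<open>preinj n\<close> these dimensions are \<open>n + 1\<close>
  and \<open>n\<close>.\<close>

lemma hom_zero_preinj_Suc: "hom_zero R (preinj n) (preinj (Suc n))"
  unfolding hom_zero_def
proof (intro ballI, rule ccontr)
  fix h u assume h: "h \<in> left_module_hom R (preinj n) (preinj (Suc n))" and u: "u \<in> carrier (preinj n)"
    and hu: "h u \<noteq> \<zero>\<^bsub>preinj (Suc n)\<^esub>"
  let ?V = "below (Suc n) :: (nat \<Rightarrow> 'k) set" and ?W = "below n :: (nat \<Rightarrow> 'k) set"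
  let ?V' = "below (Suc (Suc n)) :: (nat \<Rightarrow> 'k) set" and ?W' = "below (Suc n) :: (nat \<Rightarrow> 'k) set"
  have rep: "is_rep ?V ?W (preinj_maps n)" and rep': "is_rep ?V' ?W' (preinj_maps (Suc n))"
    by (simp_all add: is_rep_below)
  note h' = h[unfolded preinj_def]
  obtain Ks Kt where K: "is_rep Ks Kt (preinj_maps n)" "Ks \<subseteq> ?V" "Kt \<subseteq> ?W"
    "{u \<in> ?V \<times> ?W. h u = 0} = Ks \<times> Kt"
    using kernel_hom_rep[OF rep rep_module[OF rep'] h'] by auto
  obtain Ys Yt where Y: "is_rep Ys Yt (preinj_maps (Suc n))" "Ys \<subseteq> ?V'" "Yt \<subseteq> ?W'"
    "h ` carrier (rep ?V ?W (preinj_maps n)) = Ys \<times> Yt"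
    "h \<in> left_module_hom R (rep ?V ?W (preinj_maps n)) (rep Ys Yt (preinj_maps (Suc n)))"
    using image_hom_rep[OF rep' rep_module[OF rep] h'] .
  have add: "h (u + v) = h u + h v" if "u \<in> ?V \<times> ?W" "v \<in> ?V \<times> ?W" for u v
    using left_module_hom_add[OF h', of u v] that by simp
  have K0: "0 \<in> Ks" "0 \<in> Kt" "0 \<in> ?V" "0 \<in> ?W" "0 \<in> Ys" "0 \<in> Yt"
    using seq.subspace_0 is_repD(1,2)[OF K(1)] is_repD(1,2)[OF rep] is_repD(1,2)[OF Y(1)] by blast+
  \<comment> \<open>\<open>r1\<close> and \<open>r2\<close> act as the projections to the components
    at \<open>s\<close> and \<open>t\<close>, so \<open>h\<close> respects the two
    components.\<close>
  obtain r1 where r1: "r1 \<in> carrier R" "es r1 = 1" "et r1 = 0" "\<And>i. c i r1 = 0"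
    using f_surj[of 1 0 "\<lambda>_. 0"] by auto
  obtain r2 where r2: "r2 \<in> carrier R" "es r2 = 0" "et r2 = 1" "\<And>i. c i r2 = 0"
    using f_surj[of 0 1 "\<lambda>_. 0"] by auto
  have hs: "h (x, 0) = (fst (h (x, 0)), 0)" if "x \<in> ?V" for x
    using left_module_hom_smult[OF h' r1(1), of "(x, 0)"] that K0
    by (cases "h (x, 0)") (simp add: r1)
  have ht: "h (0, y) = (0, snd (h (0, y)))" if "y \<in> ?W" for y
    using left_module_hom_smult[OF h' r2(1), of "(0, y)"] that K0
    by (cases "h (0, y)") (simp add: r2 linear_seqD(3)[OF is_repD(5)[OF rep]])
  have hsum: "h (x, y) = (fst (h (x, 0)), snd (h (0, y)))" if "x \<in> ?V" "y \<in> ?W" for x y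
  proof -
    have "h (x, y) = h (x, 0) + h (0, y)" using add[of "(x, 0)" "(0, y)"] that K0 by simp
    moreover have "snd (h (x, 0)) = 0" using arg_cong[OF hs[OF that(1)], of snd] by simp
    moreover have "fst (h (0, y)) = 0" using arg_cong[OF ht[OF that(2)], of fst] by simp
    ultimately show ?thesis by (simp add: prod_eq_iff)
  qed
  \<comment> \<open>The two components of \<open>h\<close> are extended to the whole space so that
    \<open>rank_nullity\<close> applies to them.\<close>
  obtain f where f: "seq.lin f" "\<And>x. x \<in> ?V \<Longrightarrow> f x = fst (h (x, 0))"
  proof (rule seq.linear_extension_from_subspace[OF is_repD(1)[OF rep], of "\<lambda>x. fst (h (x, 0))"])
    fix x assume x: "x \<in> ?V"
    show "fst (h (x + y, 0)) = fst (h (x, 0)) + fst (h (y, 0))" if "y \<in> ?V" for y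
      using add[of "(x, 0)" "(y, 0)"] x that K0 by simp
    show "fst (h (fscale k x, 0)) = fscale k (fst (h (x, 0)))" for k
    proof -
      obtain r where "r \<in> carrier R" "es r = k" "et r = 0" "\<And>i. c i r = 0"
        using f_surj[of k 0 "\<lambda>_. 0"] by auto
      then show ?thesis
        using left_module_hom_smult[OF h', of r "(x, 0)"] x K0 by (cases "h (x, 0)") simp
    qed
  qed blast
  obtain g where g: "seq.lin g" "\<And>y. y \<in> ?W \<Longrightarrow> g y = snd (h (0, y))"
  proof (rule seq.linear_extension_from_subspace[OF is_repD(2)[OF rep], of "\<lambda>y. snd (h (0, y))"])
    fix x assume x: "x \<in> ?W"
    show "snd (h (0, x + y)) = snd (h (0, x)) + snd (h (0, y))" if "y \<in> ?W" for y
      using add[of "(0, x)" "(0, y)"] x that K0 by simp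
    show "snd (h (0, fscale k x)) = fscale k (snd (h (0, x)))" for k
    proof -
      obtain r where "r \<in> carrier R" "es r = 0" "et r = k" "\<And>i. c i r = 0"
        using f_surj[of 0 k "\<lambda>_. 0"] by auto
      then show ?thesis
        using left_module_hom_smult[OF h', of r "(0, x)"] x K0
        by (cases "h (0, x)") (simp add: linear_seqD(3)[OF is_repD(5)[OF rep]])
    qed
  qed blast
  have hfg: "h (x, y) = (f x, g y)" if "x \<in> ?V" "y \<in> ?W" for x y
    using hsum[OF that] f g that by simp
  have "(f ` ?V) \<times> (g ` ?W) = Ys \<times> Yt"
    unfolding Y(4)[symmetric] rep_simps(1) image_Times[symmetric] using hfg by (intro image_cong) auto
  moreover have "{x \<in> ?V. f x = 0} \<times> {y \<in> ?W. g y = 0} = Ks \<times> Kt"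
    unfolding K(4)[symmetric] using hfg by (auto simp: zero_prod_def)
  ultimately have eq: "f ` ?V = Ys" "g ` ?W = Yt" "{x \<in> ?V. f x = 0} = Ks" "{y \<in> ?W. g y = 0} = Kt"
    using K0 by (auto simp: times_eq_iff)
  have dims: "seq.dim Ys + seq.dim Ks = Suc n" "seq.dim Yt + seq.dim Kt = n"
    using seq.rank_nullity[OF is_repD(3,1)[OF rep] f(1)] seq.rank_nullity[OF is_repD(4,2)[OF rep] g(1)]
    by (simp_all add: eq dim_below)
  have "seq.dim Ks \<le> seq.dim Kt"
  proof (rule proper_subrep_dim_le[OF K(1-3)])
    show "Ks \<times> Kt \<noteq> ?V \<times> ?W" using K(4) u hu by (auto simp: preinj_def)
  qed
  moreover have "seq.dim Ys \<le> seq.dim Yt"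
  proof (rule proper_subrep_dim_le[OF Y(1-3)])
    show "Ys \<times> Yt \<noteq> ?V' \<times> ?W'"
    proof
      \<comment> \<open>A full image would have dimension \<open>n + 2\<close> at \<open>s\<close>,
        but the source has only \<open>n + 1\<close> there.\<close>
      assume "Ys \<times> Yt = ?V' \<times> ?W'"
      then have "Ys = ?V'" using K0 by (auto simp: times_eq_iff)
      then show False using dims(1) by (simp add: dim_below)
    qed
  qed
  ultimately show False using dims by simp
qed

section \<open>Forcing modules into a torsion class\<close>

text \<open>A coordinate at which some vector of \<open>W\<close> is nonzero gives a nonzero map to
  \<open>line_module et\<close>, and such a map is onto.\<close>

lemma nonzero_rep_at_target:
  assumes rep: "is_rep {0} W m" and W: "W \<noteq> {0}" and T: "in_class R T (rep {0} W m)"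
  shows "in_class R T (line_module et)"
proof -
  obtain y where y: "y \<in> W" "y \<noteq> 0" using W seq.subspace_0[OF is_repD(2)[OF rep]] by auto
  then obtain i where i: "y i \<noteq> 0" by (auto simp: fun_eq_iff)
  let ?h = "\<lambda>(x, y). y i"
  have h: "?h \<in> left_module_hom R (rep {0} W m) (line_module et)"
    by (intro left_module_homI) (auto simp: fscale_def linear_seqD(3)[OF is_repD(5)[OF rep]])
  show ?thesis
    using in_class_quotient[OF T h et.nonzero_hom_to_line_surj[OF rep_module[OF rep] h, of "(0, y)"]] y i
    by simp
qed

lemma in_class_zero_rep:
  assumes "torsion_class R T" "Z \<in> T" "Z \<in> zero_modules R" "is_rep {0} {0} m"
  shows "in_class R T (rep {0} {0} m)"
proof (rule in_classI[OF assms(2), of "\<lambda>_. 0"])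
  show "(\<lambda>_. 0) \<in> left_module_hom R Z (rep {0} {0} m)"
    by (intro left_module_homI) (auto simp: zero_prod_def linear_seqD(3)[OF is_repD(5)[OF assms(4)]])
qed (use assms(3) in \<open>auto simp: zero_modules_def zero_prod_def\<close>)

text \<open>A quotient \<open>Z\<close> of \<open>preinj n\<close> that is minimal outside \<open>T\<close> admits no nonzero map from a module
  in \<open>T\<close>, because \<open>Z\<close> would be an extension of a smaller quotient by the image. But there is a
  nonzero map from \<open>Y\<close> since \<open>dim Y\<^sub>s dim Z\<^sub>s + dim Y\<^sub>t dim Z\<^sub>t - 2 dim Y\<^sub>s dim Z\<^sub>t \<ge> dim Y\<^sub>s > 0\<close>.\<close>

lemma preinj_in_class:
  assumes T: "torsion_class R T" and Z: "Z \<in> T" "Z \<in> zero_modules R"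
    and Y: "is_rep Ys Yt mY" "in_class R T (rep Ys Yt mY)" "0 < seq.dim Ys" "seq.dim Ys \<le> seq.dim Yt"
  shows "in_class R T (preinj n)"
proof (rule ccontr)
  assume not: "\<not> ?thesis"
  let ?V = "below (Suc n) :: (nat \<Rightarrow> 'k) set" and ?W = "below n :: (nat \<Rightarrow> 'k) set"
  have rep: "is_rep ?V ?W (preinj_maps n)" by (simp add: is_rep_below)
  \<comment> \<open>A quotient of \<open>preinj n\<close> is encoded by linear maps
    \<open>p\<close>, \<open>q\<close> at the two vertices together with the induced arrows
    \<open>m\<close> on their images; the bad ones lie outside \<open>T\<close>.\<close>
  define bad where "bad = (\<lambda>(p, q, m). seq.lin p \<and> seq.lin q \<and> is_rep (p ` ?V) (q ` ?W) m \<and>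
    (\<forall>i. \<forall>x\<in>?V. q (preinj_maps n i x) = m i (p x)) \<and> \<not> in_class R T (rep (p ` ?V) (q ` ?W) m))"
  have "bad (id, id, preinj_maps n)"
    using rep not seq.linear_id by (auto simp: bad_def preinj_def id_def seq.linear_ident)
  then obtain p q m where pqm: "bad (p, q, m)"
    and least: "\<And>p' q' m'. bad (p', q', m') \<Longrightarrow>
      seq.dim (p ` ?V) + seq.dim (q ` ?W) \<le> seq.dim (p' ` ?V) + seq.dim (q' ` ?W)"
    using ex_has_least_nat[of bad _ "\<lambda>(p, q, m). seq.dim (p ` ?V) + seq.dim (q ` ?W)"] by fast
  define Zs where "Zs = p ` ?V"
  define Zt where "Zt = q ` ?W"
  have lin: "seq.lin p" "seq.lin q" and repZ: "is_rep Zs Zt m"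
    and comm: "\<And>i x. x \<in> ?V \<Longrightarrow> q (preinj_maps n i x) = m i (p x)"
    and notZ: "\<not> in_class R T (rep Zs Zt m)"
    using pqm by (auto simp: bad_def Zs_def Zt_def)
  note DZ = is_repD[OF repZ] and DY = is_repD[OF Y(1)]
  have hom: "(\<lambda>(x, y). (p x, q y)) \<in> left_module_hom R (rep ?V ?W (preinj_maps n)) (rep Zs Zt m)"
    using lin comm is_repD(6)[OF rep] by (intro rep_hom) (auto simp: Zs_def Zt_def)
  obtain Ks Kt where K: "is_rep Ks Kt (preinj_maps n)" "Ks \<subseteq> ?V" "Kt \<subseteq> ?W"
    "{u \<in> ?V \<times> ?W. (case u of (x, y) \<Rightarrow> (p x, q y)) = \<zero>\<^bsub>rep Zs Zt m\<^esub>} = Ks \<times> Kt"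
    using kernel_hom_rep[OF rep rep_module[OF repZ] hom] .
  have "{x \<in> ?V. p x = 0} \<times> {y \<in> ?W. q y = 0} = Ks \<times> Kt"
    unfolding K(4)[symmetric] by (auto simp: zero_prod_def)
  then have kereq: "{x \<in> ?V. p x = 0} = Ks" "{y \<in> ?W. q y = 0} = Kt"
    using seq.subspace_0[OF is_repD(1)[OF rep]] seq.subspace_0[OF is_repD(2)[OF rep]] linear_seqD(3)[OF lin(1)]
      linear_seqD(3)[OF lin(2)] by (auto simp: times_eq_iff)
  \<comment> \<open>The zero module is in \<open>T\<close>, so \<open>Z\<close> is nonzero and the
    kernel proper. Out of \<open>(n + 1, n)\<close> the kernel takes at \<open>t\<close> at least as
    much as at \<open>s\<close>, which leaves \<open>Z\<close> strictly larger at
    \<open>s\<close>.\<close>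
  have "seq.dim Ks \<le> seq.dim Kt"
  proof (rule proper_subrep_dim_le[OF K(1-3)])
    show "Ks \<times> Kt \<noteq> ?V \<times> ?W"
    proof
      assume "Ks \<times> Kt = ?V \<times> ?W"
      then have "Ks = ?V" "Kt = ?W"
        using seq.subspace_0[OF is_repD(1)[OF rep]] seq.subspace_0[OF is_repD(2)[OF rep]] by (auto simp: times_eq_iff)
      then have "Zs = {0}" "Zt = {0}"
        using kereq seq.subspace_0[OF DZ(1)] seq.subspace_0[OF DZ(2)] by (auto simp: Zs_def Zt_def)
      then show False using notZ repZ in_class_zero_rep[OF T Z] by simp
    qed
  qed
  moreover have "seq.dim Zs + seq.dim Ks = Suc n" "seq.dim Zt + seq.dim Kt = n"
    using seq.rank_nullity[OF is_repD(3,1)[OF rep] lin(1)] seq.rank_nullity[OF is_repD(4,2)[OF rep] lin(2)]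
    by (simp_all add: kereq dim_below Zs_def Zt_def)
  ultimately have dimZ: "Suc (seq.dim Zt) \<le> seq.dim Zs" by simp
  have "2 * (seq.dim Ys * seq.dim Zt) < seq.dim Ys * seq.dim Zs + seq.dim Yt * seq.dim Zt"
  proof -
    have "seq.dim Ys * Suc (seq.dim Zt) \<le> seq.dim Ys * seq.dim Zs" using dimZ by (rule mult_le_mono2)
    moreover have "seq.dim Ys * seq.dim Zt \<le> seq.dim Yt * seq.dim Zt" using Y(4) by (rule mult_le_mono1)
    ultimately show ?thesis using Y(3) unfolding mult_Suc_right by linarith
  qed
  moreover have "mY i ` Ys \<subseteq> Yt" "m i ` Zs \<subseteq> Zt" for i using DY(6) DZ(6) by blast+
  ultimately obtain f g where fg: "seq.lin f" "seq.lin g" "f ` Ys \<subseteq> Zs" "g ` Yt \<subseteq> Zt"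
    "\<And>i x. x \<in> Ys \<Longrightarrow> g (mY i x) = m i (f x)"
    "(\<exists>x\<in>Ys. f x \<noteq> 0) \<or> (\<exists>y\<in>Yt. g y \<noteq> 0)"
    using seq.exists_nonzero_commuting_maps[OF DY(1,2) DZ(1,2) DY(3,4) DZ(3,4), of mY m] DY(5) DZ(5)
    by blast
  interpret f: Vector_Spaces.linear fscale fscale f by (rule fg(1))
  interpret g: Vector_Spaces.linear fscale fscale g by (rule fg(2))
  have repI: "is_rep (f ` Ys) (g ` Yt) m"
    unfolding is_rep_def
  proof (intro conjI allI)
    show "seq.subspace (f ` Ys)" "seq.subspace (g ` Yt)"
      using f.subspace_image[OF DY(1)] g.subspace_image[OF DY(2)] .
    show "seq.fin_dim (f ` Ys)" "seq.fin_dim (g ` Yt)"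
      using seq.fin_dim_image[OF fg(1) DY(3)] seq.fin_dim_image[OF fg(2) DY(4)] .
    show "seq.lin (m i)" for i by (rule DZ(5))
    show "m i ` f ` Ys \<subseteq> g ` Yt" for i
      using DY(6) by (auto simp flip: fg(5))
  qed
  have classI: "in_class R T (rep (f ` Ys) (g ` Yt) m)"
  proof (rule in_class_quotient[OF Y(2)])
    show "(\<lambda>(x, y). (f x, g y)) \<in> left_module_hom R (rep Ys Yt mY) (rep (f ` Ys) (g ` Yt) m)"
      using fg(1,2,5) DY(6) by (intro rep_hom) auto
  qed (simp add: image_Times)
  obtain p' q' where q: "seq.lin p'" "seq.lin q'" "\<And>x. p' x = 0 \<longleftrightarrow> x \<in> f ` Ys" "\<And>x. q' x = 0 \<longleftrightarrow> x \<in> g ` Yt"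
    "is_rep (p' ` Zs) (q' ` Zt) (\<lambda>i. q' \<circ> m i)" "\<And>i x. (q' \<circ> m i) (p' x) = q' (m i x)"
    using rep_quotient[OF repZ repI fg(3,4)] by blast
  have repQ: "in_class R T (rep (p' ` Zs) (q' ` Zt) (\<lambda>i. q' \<circ> m i))"
  proof (rule ccontr)
    assume "\<not> ?thesis"
    \<comment> \<open>The quotient of \<open>Z\<close> by the image of \<open>Y\<close> is again a
      quotient of \<open>preinj n\<close>. If it were bad, minimality would force the image to be
      zero.\<close>
    then have "bad (p' \<circ> p, q' \<circ> q, \<lambda>i. q' \<circ> m i)"
      using q(5,6) comm Vector_Spaces.linear_compose[OF lin(1) q(1)] Vector_Spaces.linear_compose[OF lin(2) q(2)]
      by (simp add: bad_def Zs_def Zt_def image_image)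
    then have le: "seq.dim Zs + seq.dim Zt \<le> seq.dim (p' ` Zs) + seq.dim (q' ` Zt)"
      using least by (fastforce simp: Zs_def Zt_def image_image)
    have "{x \<in> Zs. p' x = 0} = f ` Ys" "{x \<in> Zt. q' x = 0} = g ` Yt" using q(3,4) fg(3,4) by auto
    then have "seq.dim (p' ` Zs) + seq.dim (f ` Ys) = seq.dim Zs" "seq.dim (q' ` Zt) + seq.dim (g ` Yt) = seq.dim Zt"
      using seq.rank_nullity[OF DZ(3,1) q(1)] seq.rank_nullity[OF DZ(4,2) q(2)] by simp_all
    then have "seq.dim (f ` Ys) = 0" "seq.dim (g ` Yt) = 0" using le by simp_all
    then have "f ` Ys = {0}" "g ` Yt = {0}"
      using seq.fin_dim_dim_eq_0 is_repD(1-4)[OF repI] by blast+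
    then show False using fg(6) by blast
  qed
  have "in_class R T (rep Zs Zt m)"
  proof (rule rep_extension[OF T repZ repI fg(3,4) rep_module[OF q(5)] rep_fg[OF q(5)] repQ _ _ _ classI])
    show "(\<lambda>(x, y). (p' x, q' y)) \<in> left_module_hom R (rep Zs Zt m) (rep (p' ` Zs) (q' ` Zt) (\<lambda>i. q' \<circ> m i))"
      using q(1,2,6) DZ(6) by (intro rep_hom) auto
    show "(\<lambda>(x, y). (p' x, q' y)) ` (Zs \<times> Zt) = carrier (rep (p' ` Zs) (q' ` Zt) (\<lambda>i. q' \<circ> m i))"
      by (simp add: image_Times)
    show "{u \<in> Zs \<times> Zt. (case u of (x, y) \<Rightarrow> (p' x, q' y)) =
        \<zero>\<^bsub>rep (p' ` Zs) (q' ` Zt) (\<lambda>i. q' \<circ> m i)\<^esub>} = f ` Ys \<times> g ` Yt"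
      using q(3,4) fg(3,4) by (auto simp: zero_prod_def)
  qed
  then show False using notZ by blast
qed

text \<open>Suppose \<open>line_module et\<close> is not in \<open>T\<close>. Some member of
  \<open>T\<close> has a nonzero image in \<open>preinj (Suc n)\<close>. The image is proper,
  because \<open>preinj n\<close> is a quotient of \<open>preinj (Suc n)\<close>, and it is nonzero
  at \<open>s\<close>, because otherwise \<open>line_module et\<close> would be a quotient of it.
  Then \<open>preinj_in_class\<close> applies.\<close>

lemma cover_not_all_preinj:
  assumes cov: "torsion_cover R T T'" and Z: "Z \<in> T" "Z \<in> zero_modules R"
    and all: "\<And>n. in_class R T' (preinj n)" and n: "\<not> in_class R T (preinj n)"
  shows "in_class R T (line_module et)"
proof (rule ccontr)
  assume not: "\<not> ?thesis"
  have T: "torsion_class R T" using cov by (simp add: torsion_cover_def)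
  let ?V = "below (Suc (Suc n)) :: (nat \<Rightarrow> 'k) set" and ?W = "below (Suc n) :: (nat \<Rightarrow> 'k) set"
  have rep: "is_rep ?V ?W (preinj_maps (Suc n))" by (simp add: is_rep_below)
  have ne: "carrier (preinj (Suc n)) \<noteq> {\<zero>\<^bsub>preinj (Suc n)\<^esub>}"
  proof
    assume "carrier (preinj (Suc n)) = {\<zero>\<^bsub>preinj (Suc n)\<^esub>}"
    moreover have "(unit_seq 0, 0) \<in> carrier (preinj (Suc n))"
      by (simp add: preinj_def below_def unit_seq_def)
    ultimately have "(unit_seq 0, 0) = (0 :: (nat \<Rightarrow> 'k) \<times> (nat \<Rightarrow> 'k))" by (simp add: preinj_def)
    then have "unit_seq 0 (0::nat) = (0::'k)" by (simp add: zero_prod_def)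
    then show False by (simp add: unit_seq_def)
  qed
  obtain Y h y where Y: "Y \<in> T" and h: "h \<in> left_module_hom R Y (preinj (Suc n))"
    and y: "y \<in> carrier Y" "h y \<noteq> \<zero>\<^bsub>preinj (Suc n)\<^esub>"
    using torsion_cover_nonzero_hom[OF cov Z preinj_module preinj_fg all ne preinj_module preinj_fg all n
        hom_zero_preinj_Suc] .
  obtain Ys Yt where I: "is_rep Ys Yt (preinj_maps (Suc n))" "Ys \<subseteq> ?V" "Yt \<subseteq> ?W" "h ` carrier Y = Ys \<times> Yt"
    "h \<in> left_module_hom R Y (rep Ys Yt (preinj_maps (Suc n)))"
    using image_hom_rep[OF rep fg_modules_left_module[OF torsion_class_fg[OF T Y]] h[unfolded preinj_def]] .
  have cls: "in_class R T (rep Ys Yt (preinj_maps (Suc n)))"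
    using in_classI[OF Y I(5)] I(4) by simp
  have "seq.dim Ys \<le> seq.dim Yt"
  proof (rule proper_subrep_dim_le[OF I(1-3)])
    show "Ys \<times> Yt \<noteq> ?V \<times> ?W"
    proof
      assume "Ys \<times> Yt = ?V \<times> ?W"
      then have "Ys = ?V" "Yt = ?W"
        using seq.subspace_0[OF is_repD(1)[OF rep]] seq.subspace_0[OF is_repD(2)[OF rep]] by (auto simp: times_eq_iff)
      then have "in_class R T (preinj (Suc n))" using cls by (simp add: preinj_def)
      then show False using in_class_preinj_Suc n by blast
    qed
  qed
  moreover have "Ys \<noteq> {0}"
  proof
    assume Ys: "Ys = {0}"
    moreover have "Yt \<noteq> {0}" using I(4) y Ys by (auto simp: preinj_def zero_prod_def)
    ultimately show False using nonzero_rep_at_target I(1) cls not by blast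
  qed
  then have "0 < seq.dim Ys"
    using seq.fin_dim_dim_eq_0[OF is_repD(3,1)[OF I(1)]] by blast
  ultimately show False using preinj_in_class[OF T Z I(1) cls] n by blast
qed

end

section \<open>Maximal green sequences\<close>

lemma maximal_green_sequence_mono:
  assumes "maximal_green_sequence R r T" "i \<le> j" "j \<le> r"
  shows "T i \<subseteq> T j"
  using assms(2,3)
proof (induction j rule: dec_induct)
  case (step j)
  have "\<forall>i<r. T i \<subset> T (Suc i)" using assms(1) unfolding maximal_green_sequence_def by (elim conjE)
  then have "T j \<subset> T (Suc j)" using step.prems by simp
  then show ?case using step.IH step.prems by simp
qed simp

lemma maximal_green_sequence_cover:
  assumes "maximal_green_sequence R r T" "i < r"
  shows "torsion_cover R (T i) (T (Suc i))"
proof -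
  have "torsion_class R (T i)" "torsion_class R (T (Suc i))" "T i \<subset> T (Suc i)"
    using assms by (simp_all add: maximal_green_sequence_def)
  moreover have "\<forall>i<r. \<forall>T'. torsion_class R T' \<and> T i \<subseteq> T' \<and> T' \<subseteq> T (Suc i) \<longrightarrow> T' = T i \<or> T' = T (Suc i)"
    using assms(1) unfolding maximal_green_sequence_def by (elim conjE)
  ultimately show ?thesis using assms(2) by (simp add: torsion_cover_def)
qed

lemma not_in_class_zero_modules:
  assumes "x \<in> carrier M" "y \<in> carrier M" "x \<noteq> y"
  shows "\<not> in_class R (zero_modules R) M"
proof
  assume "in_class R (zero_modules R) M"
  then obtain N f where "N \<in> zero_modules R" "f ` carrier N = carrier M" by (auto simp: in_class_def)
  then have "carrier M = {f \<zero>\<^bsub>N\<^esub>}" by (auto simp: zero_modules_def)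
  then show False using assms by auto
qed

lemma in_class_fg_modules: "left_module R M \<Longrightarrow> finitely_generated_module R M \<Longrightarrow> in_class R (fg_modules R) M"
  by (intro has_copy_in_class fg_has_copy)

text \<open>At the step from \<open>T s\<close> to \<open>T (Suc s)\<close> that completes the
  preinjective family, \<open>T s\<close> contains \<open>line_module et\<close>. It cannot contain
  \<open>line_module es\<close> as well, for the two would generate every \<open>preinj n\<close>;
  so \<open>i < s\<close> is impossible.\<close>

lemma (in kronecker) maximal_green_sequence_target_if_source:
  assumes mgs: "maximal_green_sequence R r T" and i: "i \<le> r" "in_class R (T i) (line_module es)"
  shows "in_class R (T i) (line_module et)"
proof -
  define P where "P i \<longleftrightarrow> (\<forall>n. in_class R (T i) (preinj n))" for i
  have T: "T 0 = zero_modules R" "T r = fg_modules R" "\<And>i. i \<le> r \<Longrightarrow> torsion_class R (T i)"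
    using mgs by (auto simp: maximal_green_sequence_def)
  have "(unit_seq 0, 0) \<in> carrier (preinj 0)" "(0, 0) \<in> carrier (preinj 0)"
    by (auto simp: preinj_def below_def unit_seq_def)
  moreover have "(unit_seq 0 :: nat \<Rightarrow> 'k) \<noteq> 0" by (auto simp: unit_seq_def fun_eq_iff)
  ultimately have "\<not> P 0"
    unfolding P_def T(1) using not_in_class_zero_modules[of "(unit_seq 0, 0)" "preinj 0" "(0, 0)" R] by blast
  moreover have "P r" unfolding P_def T(2) using in_class_fg_modules preinj_module preinj_fg by blast
  ultimately obtain s where s: "s < r" "\<not> P s" "P (Suc s)" using ex_least_nat_less[of P r] by blast
  obtain Z where Z: "Z \<in> T 0" using torsion_class_nonempty[OF T(3)[of 0]] by auto
  then have Zs: "Z \<in> T s" "Z \<in> zero_modules R"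
    using maximal_green_sequence_mono[OF mgs, of 0 s] s T(1) by auto
  have t: "in_class R (T s) (line_module et)"
    using cover_not_all_preinj[OF maximal_green_sequence_cover[OF mgs s(1)] Zs] s(2,3) by (auto simp: P_def)
  show ?thesis
  proof (cases "s \<le> i")
    case True
    then show ?thesis using in_class_mono[OF t maximal_green_sequence_mono[OF mgs _ i(1)]] by blast
  next
    case False
    then have "in_class R (T s) (line_module es)"
      using in_class_mono[OF i(2) maximal_green_sequence_mono[OF mgs]] s(1) by simp
    then show ?thesis using in_class_preinj[OF T(3) _ t] s by (auto simp: P_def)
  qed
qed

text \<open>The step that adds the simple module at 1 also adds the one at 2. As only the zero map
  leads from the latter to the former, \<open>torsion_cover_nonzero_hom\<close> gives a nonzero map
  to the module at 1 from a member of the smaller class.\<close>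

lemma no_maximal_green_sequence_cyclic:
  assumes "kronecker R e2 e1 a" "kronecker R e1 e3 b" "kronecker R e3 e2 c"
  shows "\<not> maximal_green_sequence R r T"
proof
  assume mgs: "maximal_green_sequence R r T"
  interpret a: kronecker R e2 e1 a by fact
  interpret b: kronecker R e1 e3 b by fact
  interpret c: kronecker R e3 e2 c by fact
  define P where "P i \<longleftrightarrow> in_class R (T i) (line_module e1)" for i
  \<comment> \<open>Once round the cycle: 1 forces 3, 3 forces 2, and 2 forces 1.\<close>
  have P2: "in_class R (T i) (line_module e2) \<longleftrightarrow> P i" if "i \<le> r" for i
    unfolding P_def using that a.maximal_green_sequence_target_if_source[OF mgs]
      b.maximal_green_sequence_target_if_source[OF mgs] c.maximal_green_sequence_target_if_source[OF mgs] by blast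
  have T: "T 0 = zero_modules R" "T r = fg_modules R" "\<And>i. i \<le> r \<Longrightarrow> torsion_class R (T i)"
    using mgs by (auto simp: maximal_green_sequence_def)
  have "\<not> P 0"
    unfolding P_def T(1) using not_in_class_zero_modules[of 0 "line_module e1" 1] by simp
  moreover have "P r" unfolding P_def T(2) by (intro in_class_fg_modules a.et.line_module a.et.line_module_fg)
  ultimately obtain s where s: "s < r" "\<not> P s" "P (Suc s)" using ex_least_nat_less[of P r] by blast
  obtain Z where Z: "Z \<in> T 0" using torsion_class_nonempty[OF T(3)[of 0]] by auto
  then have Zs: "Z \<in> T s" "Z \<in> zero_modules R"
    using maximal_green_sequence_mono[OF mgs, of 0 s] s T(1) by auto
  have zero: "hom_zero R (line_module e2) (line_module e1)"
    unfolding hom_zero_def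
  proof (intro ballI)
    fix h x assume h: "h \<in> left_module_hom R (line_module e2) (line_module e1)"
    \<comment> \<open>\<open>r\<close> acts as zero on the module at 2 and as the identity on the
      module at 1.\<close>
    obtain r where r: "r \<in> carrier R" "e2 r = 0" "e1 r = 1" using a.f_surj by metis
    have "h 0 = 0" using left_module_hom_zero[OF a.es.line_module a.et.line_module h] by simp
    then show "h x = \<zero>\<^bsub>line_module e1\<^esub>"
      using left_module_hom_smult[OF h r(1), of x] r by simp
  qed
  have ne: "carrier (line_module e1) \<noteq> {\<zero>\<^bsub>line_module e1\<^esub>}"
    by (simp add: UNIV_eq_I) (metis UNIV_I one_neq_zero singletonD)
  have cls: "in_class R (T (Suc s)) (line_module e1)" "in_class R (T (Suc s)) (line_module e2)"
    "\<not> in_class R (T s) (line_module e2)"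
    using s P2 by (auto simp: P_def)
  obtain Y h y where Y: "Y \<in> T s" "h \<in> left_module_hom R Y (line_module e1)" "y \<in> carrier Y"
    "h y \<noteq> \<zero>\<^bsub>line_module e1\<^esub>"
    using torsion_cover_nonzero_hom[OF maximal_green_sequence_cover[OF mgs s(1)] Zs
        a.et.line_module a.et.line_module_fg cls(1) ne a.es.line_module a.es.line_module_fg cls(2,3) zero] .
  have "left_module R Y" using torsion_class_fg[OF T(3) Y(1)] s fg_modules_left_module by auto
  \<comment> \<open>A nonzero map to a simple module is onto, which puts
    \<open>line_module e1\<close> into \<open>T s\<close> already.\<close>
  then have "h ` carrier Y = carrier (line_module e1)"
    by (rule a.et.nonzero_hom_to_line_surj) (use Y in auto)
  then show False using in_classI[OF Y(1,2)] s(2) by (auto simp: P_def)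
qed

section \<open>Coefficients at short paths\<close>

lemma path_algebra_simps:
  "carrier (path_algebra Q) = {f. Poly_Mapping.keys f \<subseteq> paths Q}"
  "f \<oplus>\<^bsub>path_algebra Q\<^esub> g = f + g" "f \<otimes>\<^bsub>path_algebra Q\<^esub> g = path_mult f g"
  "\<zero>\<^bsub>path_algebra Q\<^esub> = 0" "\<one>\<^bsub>path_algebra Q\<^esub> = (\<Sum>v\<in>verts Q. Poly_Mapping.single (v, [], v) 1)"
  by (simp_all add: path_algebra_def)

lemma trivial_path_ends: "(u, [], v) \<in> paths Q \<Longrightarrow> u = v"
  by (simp add: paths_def pre_digraph.awalk_def pre_digraph.cas.simps)

text \<open>A trivial path factors only into trivial paths. Bilinearity reduces the claim to single
  paths, and membership in \<open>paths Q\<close> excludes triples \<open>(u, [], v)\<close> with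
  \<open>u \<noteq> v\<close>.\<close>

lemma lookup_path_mult_vertex:
  fixes f g :: "('v, 'e) qpath \<Rightarrow>\<^sub>0 'k::field"
  assumes "Poly_Mapping.keys f \<subseteq> paths Q" "Poly_Mapping.keys g \<subseteq> paths Q"
  shows "Poly_Mapping.lookup (path_mult f g) (v, [], v) =
    Poly_Mapping.lookup f (v, [], v) * Poly_Mapping.lookup g (v, [], v)"
  using assms(1)
proof (induction f rule: poly_mapping_add_induct)
  case (single p a)
  show ?case
    using assms(2)
  proof (induction g rule: poly_mapping_add_induct)
    case (single q b)
    obtain u1 es1 v1 u2 es2 v2 where pq: "p = (u1, es1, v1)" "q = (u2, es2, v2)"
      by (metis prod_cases3)
    have "es1 = [] \<Longrightarrow> u1 = v1" using \<open>p \<in> paths Q\<close> pq(1) trivial_path_ends[of u1 v1 Q] by simp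
    moreover have "es2 = [] \<Longrightarrow> u2 = v2" using \<open>q \<in> paths Q\<close> pq(2) trivial_path_ends[of u2 v2 Q] by simp
    ultimately show ?case
      by (cases es1; cases es2) (auto simp: pq path_mult_single path_comp_def lookup_single when_def)
  qed (simp_all add: path_mult_add_right lookup_add distrib_left)
qed (simp_all add: path_mult_add_left lookup_add distrib_right)

text \<open>A path of length one factors in exactly two ways, with a trivial path at its source or
  at its target.\<close>

lemma lookup_path_mult_arrow:
  fixes f g :: "('v, 'e) qpath \<Rightarrow>\<^sub>0 'k::field"
  assumes "Poly_Mapping.keys f \<subseteq> paths Q" "Poly_Mapping.keys g \<subseteq> paths Q"
  shows "Poly_Mapping.lookup (path_mult f g) (u, [e], v) =
    Poly_Mapping.lookup f (u, [e], v) * Poly_Mapping.lookup g (u, [], u) +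
    Poly_Mapping.lookup f (v, [], v) * Poly_Mapping.lookup g (u, [e], v)"
  using assms(1)
proof (induction f rule: poly_mapping_add_induct)
  case (single p a)
  show ?case
    using assms(2)
  proof (induction g rule: poly_mapping_add_induct)
    case (single q b)
    obtain u1 es1 v1 u2 es2 v2 where pq: "p = (u1, es1, v1)" "q = (u2, es2, v2)"
      by (metis prod_cases3)
    have "es1 = [] \<Longrightarrow> u1 = v1" using \<open>p \<in> paths Q\<close> pq(1) trivial_path_ends[of u1 v1 Q] by simp
    moreover have "es2 = [] \<Longrightarrow> u2 = v2" using \<open>q \<in> paths Q\<close> pq(2) trivial_path_ends[of u2 v2 Q] by simp
    ultimately show ?case
      by (cases es1; cases es2) (auto simp: pq path_mult_single path_comp_def lookup_single when_def)
  qed (simp_all add: path_mult_add_right lookup_add algebra_simps)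
qed (simp_all add: path_mult_add_left lookup_add algebra_simps)

text \<open>The elements without trivial paths form an ideal that contains all arrows, hence also
  the ideal generated by them.\<close>

lemma arrow_ideal_lookup_vertex:
  fixes f :: "('v, 'e) qpath \<Rightarrow>\<^sub>0 'k::field"
  assumes "fin_digraph Q" "f \<in> arrow_ideal Q"
  shows "Poly_Mapping.keys f \<subseteq> paths Q" "Poly_Mapping.lookup f (v, [], v) = 0"
proof -
  interpret Q: fin_digraph Q by fact
  let ?A = "path_algebra Q :: (('v, 'e) qpath \<Rightarrow>\<^sub>0 'k) ring"
  interpret A: ring ?A by (rule path_algebra_ring[OF assms(1)])
  let ?L = "{f :: ('v, 'e) qpath \<Rightarrow>\<^sub>0 'k. Poly_Mapping.keys f \<subseteq> paths Q \<and> (\<forall>v. Poly_Mapping.lookup f (v, [], v) = 0)}"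
  have "ideal ?L ?A"
  proof (rule idealI[OF A.ring_axioms])
    show "subgroup ?L (add_monoid ?A)"
    proof (rule group.subgroupI[OF A.a_group])
      show "?L \<noteq> {}" by (auto intro: exI[of _ 0])
      fix f assume f: "f \<in> ?L"
      have "inv\<^bsub>add_monoid ?A\<^esub> f = - f"
        using f A.minus_equality[of "- f" f] by (simp add: a_inv_def path_algebra_simps)
      then show "inv\<^bsub>add_monoid ?A\<^esub> f \<in> ?L" using f by simp
      fix g assume "g \<in> ?L"
      then show "f \<otimes>\<^bsub>add_monoid ?A\<^esub> g \<in> ?L"
        using f Poly_Mapping.keys_add[of f g] by (auto simp: path_algebra_simps lookup_add)
    qed (auto simp: path_algebra_simps)
  next
    fix f g assume "f \<in> ?L" "g \<in> carrier ?A"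
    then show "g \<otimes>\<^bsub>?A\<^esub> f \<in> ?L" "f \<otimes>\<^bsub>?A\<^esub> g \<in> ?L"
      using keys_path_mult[OF Q.wf_digraph, of f g] keys_path_mult[OF Q.wf_digraph, of g f]
        lookup_path_mult_vertex[of f Q g] lookup_path_mult_vertex[of g Q f]
      by (simp_all add: path_algebra_simps)
  qed
  moreover have "{Poly_Mapping.single (tail Q e, [e], head Q e) 1 | e. e \<in> arcs Q} \<subseteq> ?L"
    by (auto simp: paths_def pre_digraph.awalk_def pre_digraph.cas.simps lookup_single when_def)
  ultimately have "arrow_ideal Q \<subseteq> ?L"
    unfolding arrow_ideal_def by (rule A.genideal_minimal)
  then show "Poly_Mapping.keys f \<subseteq> paths Q" "Poly_Mapping.lookup f (v, [], v) = 0" using assms(2) by auto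
qed

text \<open>\<open>I\<close> lies in the square of the arrow ideal, and a product of two elements
  without trivial paths has no terms of length at most one.\<close>

lemma admissible_ideal_lookup:
  fixes I :: "(('v, 'e) qpath \<Rightarrow>\<^sub>0 'k::field) set"
  assumes "fin_digraph Q" "admissible_ideal Q I" "f \<in> I"
  shows "Poly_Mapping.lookup f (v, [], v) = 0" "Poly_Mapping.lookup f (u, [e], v) = 0"
proof -
  interpret Q: fin_digraph Q by fact
  let ?A = "path_algebra Q :: (('v, 'e) qpath \<Rightarrow>\<^sub>0 'k) ring"
  let ?J = "arrow_ideal Q :: (('v, 'e) qpath \<Rightarrow>\<^sub>0 'k) set"
  note J = arrow_ideal_lookup_vertex[OF assms(1)]
  \<comment> \<open>Powers in \<open>ideals_set\<close> start from the unit, which is the whole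
    ring, so the square unfolds to (ring times \<open>J\<close>) times \<open>J\<close>; this is the
    inner product.\<close>
  have 1: "Poly_Mapping.keys g \<subseteq> paths Q \<and> (\<forall>v. Poly_Mapping.lookup g (v, [], v) = 0)"
    if "g \<in> ideal_prod ?A (carrier ?A) ?J" for g
    using that
  proof (induction rule: ideal_prod.induct)
    case (prod g h)
    then show ?case
      using J[of h] lookup_path_mult_vertex[of g Q h] keys_path_mult[OF Q.wf_digraph, of g h]
      by (simp add: path_algebra_simps)
  next
    case (sum g h)
    then show ?case using Poly_Mapping.keys_add[of g h] by (auto simp: path_algebra_simps lookup_add)
  qed
  have 2: "Poly_Mapping.lookup g (v, [], v) = 0 \<and> Poly_Mapping.lookup g (u, [e], v) = 0"
    if "g \<in> ideal_prod ?A (ideal_prod ?A (carrier ?A) ?J) ?J" for g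
    using that
  proof (induction rule: ideal_prod.induct)
    case (prod g h)
    then show ?case
      using J[of h] 1[of g] lookup_path_mult_vertex[of g Q h] lookup_path_mult_arrow[of g Q h]
      by (simp add: path_algebra_simps)
  next
    case (sum g h)
    then show ?case by (auto simp: path_algebra_simps lookup_add)
  qed
  have "?J [^]\<^bsub>ideals_set ?A\<^esub> (2::nat) = ideal_prod ?A (ideal_prod ?A (carrier ?A) ?J) ?J"
    by (simp add: numeral_2_eq_2 monoid.nat_pow_Suc nat_pow_def ideals_set_def)
  then show "Poly_Mapping.lookup f (v, [], v) = 0" "Poly_Mapping.lookup f (u, [e], v) = 0"
    using 2[of f] assms(2,3) by (auto simp: admissible_ideal_def)
qed

text \<open>Meaningful only if the coefficient at \<open>p\<close> is constant on the coset \<open>X\<close>.\<close>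

definition coset_coeff :: "('v, 'e) qpath \<Rightarrow> (('v, 'e) qpath \<Rightarrow>\<^sub>0 'k::field) set \<Rightarrow> 'k" where
  "coset_coeff p X = Poly_Mapping.lookup (SOME f. f \<in> X) p"

section \<open>Kronecker quotients of the algebra\<close>

lemma coset_coeff_eq:
  assumes "ring (path_algebra Q)" "ideal I (path_algebra Q)"
    and "\<And>f. f \<in> I \<Longrightarrow> Poly_Mapping.lookup f p = 0" and "f \<in> carrier (path_algebra Q)"
  shows "coset_coeff p (I +>\<^bsub>path_algebra Q\<^esub> f) = Poly_Mapping.lookup f p"
proof -
  interpret ideal I "path_algebra Q" by fact
  have "f \<in> I +>\<^bsub>path_algebra Q\<^esub> f" using assms(4) by (rule a_rcos_self)
  then have "(SOME g. g \<in> I +>\<^bsub>path_algebra Q\<^esub> f) \<in> I +>\<^bsub>path_algebra Q\<^esub> f" by (rule someI)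
  then obtain i where "i \<in> I" "(SOME g. g \<in> I +>\<^bsub>path_algebra Q\<^esub> f) = i + f"
    by (auto simp: a_r_coset_def' path_algebra_simps)
  then show ?thesis by (simp add: coset_coeff_def lookup_add assms(3))
qed

text \<open>Coefficients at paths of length at most one vanish on \<open>I\<close>, so they descend
  to the quotient; their behaviour under products is that of \<open>lookup_path_mult_vertex\<close>
  and \<open>lookup_path_mult_arrow\<close>.\<close>

lemma kronecker_quotient:
  fixes I :: "(('v, 'e) qpath \<Rightarrow>\<^sub>0 'k::field) set"
  assumes Q: "fin_digraph Q" "admissible_ideal Q I"
    and a: "a \<in> arcs Q" "a' \<in> arcs Q" "a \<noteq> a'" "arc_to_ends Q a = (s, t)" "arc_to_ends Q a' = (s, t)" "s \<noteq> t"
  shows "kronecker (path_algebra Q Quot I) (coset_coeff (s, [], s)) (coset_coeff (t, [], t))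
    (\<lambda>i. coset_coeff (s, [if i then a else a'], t))"
proof -
  interpret Q: fin_digraph Q by fact
  let ?A = "path_algebra Q :: (('v, 'e) qpath \<Rightarrow>\<^sub>0 'k) ring"
  interpret A: ring ?A by (rule path_algebra_ring[OF Q(1)])
  interpret I: ideal I ?A using Q(2) by (simp add: admissible_ideal_def)
  interpret h: ring_hom_ring ?A "?A Quot I" "\<lambda>f. I +>\<^bsub>?A\<^esub> f" by (rule I.rcos_ring_hom_ring)
  note coeff = coset_coeff_eq[OF A.ring_axioms I.ideal_axioms]
  have vert: "coset_coeff (v, [], v) (I +>\<^bsub>?A\<^esub> f) = Poly_Mapping.lookup f (v, [], v)"
    and arr: "coset_coeff (u, [e], v) (I +>\<^bsub>?A\<^esub> f) = Poly_Mapping.lookup f (u, [e], v)"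
    if "f \<in> carrier ?A" for u v e f
    using that admissible_ideal_lookup[OF Q] by (auto intro: coeff)
  have rep: "\<exists>f\<in>carrier ?A. X = I +>\<^bsub>?A\<^esub> f" if "X \<in> carrier (?A Quot I)" for X
  proof -
    have "X \<in> (\<Union>f\<in>carrier ?A. {I +>\<^bsub>?A\<^esub> f})"
      using that unfolding FactRing_def A_RCOSETS_def' by (simp only: partial_object.simps)
    then show ?thesis by (rule UN_E) (auto intro: bexI)
  qed
  have ends: "tail Q a = s" "head Q a = t" "tail Q a' = s" "head Q a' = t" using a(4,5) by (simp_all add: arc_to_ends_def)
  have st: "s \<in> verts Q" "t \<in> verts Q" using Q.tail_in_verts[OF a(1)] Q.head_in_verts[OF a(1)] ends by simp_all
  show ?thesis
  proof (intro kronecker.intro kronecker_axioms.intro h.S.ring_axioms)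
    fix X Y i assume "X \<in> carrier (?A Quot I)" "Y \<in> carrier (?A Quot I)"
    then obtain f g where f: "f \<in> carrier ?A" "X = I +>\<^bsub>?A\<^esub> f" and g: "g \<in> carrier ?A" "Y = I +>\<^bsub>?A\<^esub> g"
      using rep by metis
    note eqs = h.hom_add[OF f(1) g(1), symmetric] h.hom_mult[OF f(1) g(1), symmetric]
    have closed: "f + g \<in> carrier ?A" "path_mult f g \<in> carrier ?A"
      using A.add.m_closed[OF f(1) g(1)] A.m_closed[OF f(1) g(1)] by (simp_all add: path_algebra_simps(2,3))
    have keys: "Poly_Mapping.keys f \<subseteq> paths Q" "Poly_Mapping.keys g \<subseteq> paths Q"
      using f(1) g(1) by (simp_all add: path_algebra_simps)
    show "coset_coeff (s, [], s) (X \<oplus>\<^bsub>?A Quot I\<^esub> Y) = coset_coeff (s, [], s) X + coset_coeff (s, [], s) Y \<and>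
        coset_coeff (t, [], t) (X \<oplus>\<^bsub>?A Quot I\<^esub> Y) = coset_coeff (t, [], t) X + coset_coeff (t, [], t) Y \<and>
        coset_coeff (s, [if i then a else a'], t) (X \<oplus>\<^bsub>?A Quot I\<^esub> Y) =
          coset_coeff (s, [if i then a else a'], t) X + coset_coeff (s, [if i then a else a'], t) Y"
      unfolding f(2) g(2) eqs
      by (simp only: path_algebra_simps(2) vert[OF closed(1)] arr[OF closed(1)] vert[OF f(1)] arr[OF f(1)]
          vert[OF g(1)] arr[OF g(1)] lookup_add simp_thms)
    show "coset_coeff (s, [], s) (X \<otimes>\<^bsub>?A Quot I\<^esub> Y) = coset_coeff (s, [], s) X * coset_coeff (s, [], s) Y \<and>
        coset_coeff (t, [], t) (X \<otimes>\<^bsub>?A Quot I\<^esub> Y) = coset_coeff (t, [], t) X * coset_coeff (t, [], t) Y \<and>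
        coset_coeff (s, [if i then a else a'], t) (X \<otimes>\<^bsub>?A Quot I\<^esub> Y) =
          coset_coeff (s, [if i then a else a'], t) X * coset_coeff (s, [], s) Y +
          coset_coeff (t, [], t) X * coset_coeff (s, [if i then a else a'], t) Y"
      unfolding f(2) g(2) eqs
      by (simp only: path_algebra_simps(3) vert[OF closed(2)] arr[OF closed(2)] vert[OF f(1)] arr[OF f(1)]
          vert[OF g(1)] arr[OF g(1)] lookup_path_mult_vertex[OF keys] lookup_path_mult_arrow[OF keys] simp_thms)
  next
    have one: "\<one>\<^bsub>?A Quot I\<^esub> = I +>\<^bsub>?A\<^esub> \<one>\<^bsub>?A\<^esub>" by simp
    have sum: "Poly_Mapping.lookup (\<Sum>v\<in>verts Q. Poly_Mapping.single (v, [], v) (1::'k)) p =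
        (\<Sum>v\<in>verts Q. if (v, [], v) = p then 1 else 0)" for p
      by (simp add: lookup_sum lookup_single when_def)
    show "coset_coeff (s, [], s) \<one>\<^bsub>?A Quot I\<^esub> = 1" "coset_coeff (t, [], t) \<one>\<^bsub>?A Quot I\<^esub> = 1"
      "coset_coeff (s, [if i then a else a'], t) \<one>\<^bsub>?A Quot I\<^esub> = 0" for i
      unfolding one vert[OF A.one_closed] arr[OF A.one_closed]
      unfolding path_algebra_simps(5) sum
      using st by simp_all
  next
    fix k l :: 'k and d
    \<comment> \<open>The combination with the prescribed coefficients; \<open>s \<noteq> t\<close>
      and \<open>a \<noteq> a'\<close> keep its four paths distinct.\<close>
    let ?f = "Poly_Mapping.single (s, [], s) k + Poly_Mapping.single (t, [], t) l +
      Poly_Mapping.single (s, [a], t) (d True) + Poly_Mapping.single (s, [a'], t) (d False)"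
    have f: "?f \<in> carrier ?A"
    proof -
      have "Poly_Mapping.single p x \<in> carrier ?A" if "p \<in> paths Q" for p x
        using that by (auto simp: path_algebra_simps)
      moreover have "(s, [], s) \<in> paths Q" "(t, [], t) \<in> paths Q" "(s, [a], t) \<in> paths Q" "(s, [a'], t) \<in> paths Q"
        using a ends st by (auto simp: paths_def pre_digraph.awalk_def pre_digraph.cas.simps)
      ultimately show ?thesis using A.add.m_closed unfolding path_algebra_simps(2) by presburger
    qed
    have "I +>\<^bsub>?A\<^esub> ?f \<in> carrier (?A Quot I)" using f by (rule h.hom_closed)
    moreover have "coset_coeff (s, [], s) (I +>\<^bsub>?A\<^esub> ?f) = k" "coset_coeff (t, [], t) (I +>\<^bsub>?A\<^esub> ?f) = l"
      "coset_coeff (s, [if i then a else a'], t) (I +>\<^bsub>?A\<^esub> ?f) = d i" for i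
      unfolding vert[OF f] arr[OF f] using a(3,6) by (auto simp: lookup_add lookup_single when_def)
    ultimately show "\<exists>X\<in>carrier (?A Quot I). coset_coeff (s, [], s) X = k \<and> coset_coeff (t, [], t) X = l \<and>
        (\<forall>i. coset_coeff (s, [if i then a else a'], t) X = d i)" by blast
  qed
qed

theorem theorem4p14:
  fixes Q :: "(nat, 'e) pre_digraph"
    and I :: "((nat, 'e) qpath \<Rightarrow>\<^sub>0 'k::field) set"
  assumes "fin_digraph Q" and "verts Q = {1, 2, 3}"
    and "\<exists>H. subgraph H Q \<and> double_cyclic_triangle H"
    and "admissible_ideal Q I"
  shows "\<not> (\<exists>r \<T>. maximal_green_sequence (path_algebra Q Quot I) r \<T>)"
proof -
  obtain H where H: "subgraph H Q" "double_cyclic_triangle H" using assms(3) by blast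
  have ends: "arc_to_ends Q e = arc_to_ends H e" for e
    using H(1) by (auto simp: subgraph_def compatible_def arc_to_ends_def)
  have arcs: "arcs H \<subseteq> arcs Q" using H(1) by (auto simp: subgraph_def)
  obtain a a' b b' c c' where "distinct [a, a', b, b', c, c']" "arcs H = {a, a', b, b', c, c'}"
    "arc_to_ends Q a = (2, 1)" "arc_to_ends Q a' = (2, 1)"
    "arc_to_ends Q b = (1, 3)" "arc_to_ends Q b' = (1, 3)"
    "arc_to_ends Q c = (3, 2)" "arc_to_ends Q c' = (3, 2)"
    using H(2) unfolding double_cyclic_triangle_def ends by blast
  note abc = this
  \<comment> \<open>Each pair of parallel arrows supplies one side of the cycle through 2, 1, 3 and
    back to 2.\<close>
  have "kronecker (path_algebra Q Quot I) (coset_coeff (2, [], 2)) (coset_coeff (1, [], 1))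
      (\<lambda>i. coset_coeff (2, [if i then a else a'], 1))"
    using abc arcs by (intro kronecker_quotient assms) auto
  moreover have "kronecker (path_algebra Q Quot I) (coset_coeff (1, [], 1)) (coset_coeff (3, [], 3))
      (\<lambda>i. coset_coeff (1, [if i then b else b'], 3))"
    using abc arcs by (intro kronecker_quotient assms) auto
  moreover have "kronecker (path_algebra Q Quot I) (coset_coeff (3, [], 3)) (coset_coeff (2, [], 2))
      (\<lambda>i. coset_coeff (3, [if i then c else c'], 2))"
    using abc arcs by (intro kronecker_quotient assms) auto
  ultimately show ?thesis using no_maximal_green_sequence_cyclic by blast
qed

end
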